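(* Let $d\ge 3$ and $r\ge 2$. Let $l_i=x_i$ for $i=0,\dots,r$, let $l_{r+1}=\sum_{i=0}^r x_i$, and let $f=\sum_{i=0}^{r+1}l_i^d$. Then the differential of the Hessian map $h_{d,r}$ at $[f]$ is injective. Consequently, the differential of $h_{d,r}$ is injective at the general point of the locus of polynomials of degree $d$ and rank $r+2$ in $\Sigma(d,r)$.
   Context: Work over an algebraically closed field $k$ of characteristic zero. $\Sigma(d,r)$ is the projective space of nonzero homogeneous polynomials of degree $d$ in $x_0,\dots,x_r$ up to scalars. $\operatorname{hess}(f)=\det(\partial^2 f/\partial x_i\partial x_j)_{0\le i,j\le r}$, and the Hessian map is the rational map $h_{d,r}:\Sigma(d,r)\dashrightarrow\Sigma((r+1)(d-2),r)$, $[f]\mapsto[\operatorname{hess}(f)]$; its differential at $[f]$ (where $\operatorname{hess}(f)\neq0$) is the linear map of tangent spaces of these projective spaces. The (Waring) rank of a form $f$ of degree $d$ is the minimum $h$ such that $f$ is a sum of $h$ $d$-th powers of linear forms. The locus of polynomials of rank $r+2$ is understood as the (irreducible) closure in $\Sigma(d,r)$ of the set of classes of forms of rank $r+2$; "general point" means a point of a suitable dense Zariski open subset of it. *)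

theory Defs
  imports
    "HOL-Analysis.Abstract_Topology"
    "HOL-Library.Poly_Mapping"
    "HOL-Computational_Algebra.Polynomial"
    "Jordan_Normal_Form.Determinant"
begin

(* Polynomials in the variables 'v with coefficients in 'a: finitely supported functions
   from exponent vectors to coefficients. *)
type_synonym ('v, 'a) mpoly = "('v \<Rightarrow>\<^sub>0 nat) \<Rightarrow>\<^sub>0 'a"

(* The forms of the statement involve the variables x_0, x_1, ..., indexed by nat. *)
type_synonym 'a poly_x = "(nat, 'a) mpoly"

definition Var :: "'v \<Rightarrow> ('v, 'a::comm_ring_1) mpoly" where
  "Var i = Poly_Mapping.single (Poly_Mapping.single i 1) 1"

definition Const :: "'a \<Rightarrow> ('v, 'a::comm_ring_1) mpoly" where
  "Const c = Poly_Mapping.single 0 c"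

definition mon_degree :: "('v \<Rightarrow>\<^sub>0 nat) \<Rightarrow> nat" where
  "mon_degree m = (\<Sum>i\<in>Poly_Mapping.keys m. Poly_Mapping.lookup m i)"

definition homogeneous :: "nat \<Rightarrow> ('v, 'a::comm_ring_1) mpoly \<Rightarrow> bool" where
  "homogeneous d p \<longleftrightarrow> (\<forall>m\<in>Poly_Mapping.keys p. mon_degree m = d)"

definition eval :: "('v \<Rightarrow> 'a) \<Rightarrow> ('v, 'a::comm_ring_1) mpoly \<Rightarrow> 'a" where
  "eval x p = (\<Sum>m\<in>Poly_Mapping.keys p.
     Poly_Mapping.lookup p m * (\<Prod>i\<in>Poly_Mapping.keys m. x i ^ Poly_Mapping.lookup m i))"

(* In a summand with exponent 0 at i the subtraction truncates, but its coefficient is 0. *)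
definition partial :: "'v \<Rightarrow> ('v, 'a::comm_ring_1) mpoly \<Rightarrow> ('v, 'a) mpoly" where
  "partial i p = (\<Sum>m\<in>Poly_Mapping.keys p.
     Poly_Mapping.single (m - Poly_Mapping.single i 1)
       (of_nat (Poly_Mapping.lookup m i) * Poly_Mapping.lookup p m))"

(* Homogeneous polynomials of degree d in x_0, ..., x_r, including 0. *)
definition forms :: "nat \<Rightarrow> nat \<Rightarrow> ('a::comm_ring_1) poly_x set" where
  "forms d r = {p. homogeneous d p \<and> (\<forall>m\<in>Poly_Mapping.keys p. Poly_Mapping.keys m \<subseteq> {..r})}"

(* The coefficient ring is arbitrary: below the Hessian is also taken over k[t]. *)
definition hess :: "nat \<Rightarrow> ('a::comm_ring_1) poly_x \<Rightarrow> 'a poly_x" where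
  "hess r f = Determinant.det (Matrix.mat (r+1) (r+1) (\<lambda>(i,j). partial i (partial j f)))"

definition proj_class :: "('a::field) poly_x \<Rightarrow> 'a poly_x set" where
  "proj_class f = {Const c * f | c. c \<noteq> 0}"

definition Sigma_space :: "nat \<Rightarrow> nat \<Rightarrow> ('a::field) poly_x set set" where
  "Sigma_space d r = {proj_class f | f. f \<in> forms d r \<and> f \<noteq> 0}"

definition hessian_map :: "nat \<Rightarrow> ('a::field) poly_x set \<Rightarrow> 'a poly_x set" where
  "hessian_map r P = (\<Union>f\<in>P. proj_class (hess r f))"

definition hessian_domain :: "nat \<Rightarrow> nat \<Rightarrow> ('a::field) poly_x set set" where
  "hessian_domain d r = {P \<in> Sigma_space d r. \<forall>f\<in>P. hess r f \<noteq> 0}"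

(* Tangent vectors of the projective space P(V) are its points over k[e]/(e^2).  Such a point is
   the class of some f + e g with f nonzero, up to the units a + e b of k[e]/(e^2), where
   (a + e b)(f + e g) = a f + e (a g + b f).  We write f + e g as the pair (f, g).  For a fixed
   representative f this identifies the tangent space at [f] with V/kf (lemma
   tangent_vector_eq_iff below). *)
definition tangent_vector :: "('a::field) poly_x \<Rightarrow> 'a poly_x \<Rightarrow> ('a poly_x \<times> 'a poly_x) set" where
  "tangent_vector f g = {(Const a * f, Const a * g + Const b * f) | a b. a \<noteq> 0}"

definition tangent_space ::
  "nat \<Rightarrow> nat \<Rightarrow> ('a::field) poly_x set \<Rightarrow> ('a poly_x \<times> 'a poly_x) set set" where
  "tangent_space d r P = {tangent_vector f g | f g. f \<in> P \<and> g \<in> forms d r}"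

(* f + t g, with coefficients in k[t]. *)
definition pencil :: "('a::field) poly_x \<Rightarrow> 'a poly_x \<Rightarrow> 'a poly poly_x" where
  "pencil f g = Poly_Mapping.map (\<lambda>c. [:c:]) f + Poly_Mapping.map (\<lambda>c. [:0, c:]) g"

(* The derivative at t = 0 of hess (f + t g). *)
definition hess_deriv :: "nat \<Rightarrow> ('a::field) poly_x \<Rightarrow> 'a poly_x \<Rightarrow> 'a poly_x" where
  "hess_deriv r f g = Poly_Mapping.map (\<lambda>p. coeff p 1) (hess r (pencil f g))"

(* The differential sends the class of f + e g to the class of
   hess (f + e g) = hess f + e (hess_deriv f g).  For a fixed representative f it is thus the
   linear map V/kf -> W/k(hess f) induced by g |-> hess_deriv f g.  The union is over the
   representatives of the tangent vector; all of them give the same class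
   (lemma hessian_differential_tangent_vector below). *)
definition hessian_differential ::
  "nat \<Rightarrow> (('a::field) poly_x \<times> 'a poly_x) set \<Rightarrow> ('a poly_x \<times> 'a poly_x) set" where
  "hessian_differential r v = (\<Union>(f, g)\<in>v. tangent_vector (hess r f) (hess_deriv r f g))"

(* Zariski topology on Sigma(d,r), generated by the distinguished open sets F \<noteq> 0, where F is a
   homogeneous polynomial in the coefficients of f; the coordinates are indexed by monomials.
   F = 1 gives the whole space. *)
definition zariski_basic ::
  "nat \<Rightarrow> nat \<Rightarrow> (nat \<Rightarrow>\<^sub>0 nat, 'a::field) mpoly \<Rightarrow> 'a poly_x set set" where
  "zariski_basic d r F =
     {proj_class f | f. f \<in> forms d r \<and> f \<noteq> 0 \<and> eval (Poly_Mapping.lookup f) F \<noteq> 0}"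

definition zariski :: "nat \<Rightarrow> nat \<Rightarrow> ('a::field) poly_x set topology" where
  "zariski d r = topology_generated_by {zariski_basic d r F | F. \<exists>e. homogeneous e F}"

definition sum_of_powers :: "nat \<Rightarrow> nat \<Rightarrow> nat \<Rightarrow> ('a::comm_ring_1) poly_x \<Rightarrow> bool" where
  "sum_of_powers d r h f \<longleftrightarrow> (\<exists>l. (\<forall>i<h. l i \<in> forms 1 r) \<and> f = (\<Sum>i<h. l i ^ d))"

definition has_waring_rank :: "nat \<Rightarrow> nat \<Rightarrow> ('a::comm_ring_1) poly_x \<Rightarrow> nat \<Rightarrow> bool" where
  "has_waring_rank d r f h \<longleftrightarrow> sum_of_powers d r h f \<and> (\<forall>h'<h. \<not> sum_of_powers d r h' f)"

definition rank_locus :: "nat \<Rightarrow> nat \<Rightarrow> nat \<Rightarrow> ('a::field) poly_x set set" where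
  "rank_locus d r h = zariski d r closure_of
     {proj_class f | f. f \<in> forms d r \<and> f \<noteq> 0 \<and> has_waring_rank d r f h}"

(* Q holds at the general point of X, for X a subset of the topological space T. *)
definition at_general_point :: "'b topology \<Rightarrow> 'b set \<Rightarrow> ('b \<Rightarrow> bool) \<Rightarrow> bool" where
  "at_general_point T X Q \<longleftrightarrow>
     (\<exists>U. openin (subtopology T X) U \<and> subtopology T X closure_of U = X \<and> (\<forall>P\<in>U. Q P))"

lemma lookup_Const_mult: "Poly_Mapping.lookup (Const c * p) m = c * Poly_Mapping.lookup p m"
  unfolding Const_def mult_map_scale_conv_mult[symmetric] by (simp add: map.rep_eq when_def)

lemma Const_mult: "Const (a * b) = Const a * Const b"
  by (simp add: Const_def mult_single)

lemma Const_1: "Const 1 = 1"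
  by (simp add: Const_def)

lemma Const_0: "Const 0 = 0"
  by (simp add: Const_def)

lemma Const_power: "Const (a ^ n) = Const a ^ n"
  by (induction n) (simp_all add: Const_1 Const_mult)

lemma lookup_partial:
  "Poly_Mapping.lookup (partial i p) m =
    of_nat (Poly_Mapping.lookup m i + 1) * Poly_Mapping.lookup p (m + Poly_Mapping.single i 1)"
proof -
  have eq: "(m' - Poly_Mapping.single i 1 = m \<and> Poly_Mapping.lookup m' i \<noteq> 0) \<longleftrightarrow>
      m' = m + Poly_Mapping.single i 1" for m'
    by (auto simp: poly_mapping_eq_iff fun_eq_iff lookup_minus lookup_add lookup_single when_def)
  have "Poly_Mapping.lookup (partial i p) m = (\<Sum>m'\<in>Poly_Mapping.keys p.
      of_nat (Poly_Mapping.lookup m' i) * Poly_Mapping.lookup p m' when m' - Poly_Mapping.single i 1 = m)"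
    by (simp add: partial_def lookup_sum lookup_single)
  also have "\<dots> = (\<Sum>m'\<in>Poly_Mapping.keys p.
      of_nat (Poly_Mapping.lookup m' i) * Poly_Mapping.lookup p m' when m' = m + Poly_Mapping.single i 1)"
  proof (rule sum.cong[OF refl])
    fix m'
    show "(of_nat (Poly_Mapping.lookup m' i) * Poly_Mapping.lookup p m' when m' - Poly_Mapping.single i 1 = m) =
      (of_nat (Poly_Mapping.lookup m' i) * Poly_Mapping.lookup p m' when m' = m + Poly_Mapping.single i 1)"
    proof (cases "Poly_Mapping.lookup m' i = 0")
      case False
      then have "m' - Poly_Mapping.single i 1 = m \<longleftrightarrow> m' = m + Poly_Mapping.single i 1"
        using eq[of m'] by blast
      then show ?thesis by (simp only:)
    qed simp
  qed
  also have "\<dots> = of_nat (Poly_Mapping.lookup m i + 1) * Poly_Mapping.lookup p (m + Poly_Mapping.single i 1)"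
    by (simp add: when_def sum.delta' in_keys_iff lookup_add algebra_simps)
  finally show ?thesis .
qed

lemma partial_add: "partial i (p + q) = partial i p + partial i q"
  by (rule poly_mapping_eqI) (simp add: lookup_partial lookup_add algebra_simps)

lemma partial_Const_mult: "partial i (Const c * p) = Const c * partial i p"
  by (rule poly_mapping_eqI) (simp only: lookup_partial lookup_Const_mult mult.left_commute)

lemma hess_Const_mult: "hess r (Const c * f) = Const (c ^ (r+1)) * hess r f"
proof -
  have "Matrix.mat (r+1) (r+1) (\<lambda>(i,j). partial i (partial j (Const c * f)))
      = Const c \<cdot>\<^sub>m Matrix.mat (r+1) (r+1) (\<lambda>(i,j). partial i (partial j f))"
    by (rule eq_matI) (auto simp: partial_Const_mult)
  then show ?thesis
    unfolding hess_def by (simp add: Const_power Const_mult)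
qed

lemma proj_class_Const: "c \<noteq> 0 \<Longrightarrow> proj_class (Const c * f) = proj_class f"
  unfolding proj_class_def
proof (intro Set.set_eqI iffI, goal_cases)
  case (1 x)
  then obtain b where "x = Const b * (Const c * f)" "b \<noteq> 0" by blast
  with \<open>c \<noteq> 0\<close> show ?case
    by (intro CollectI exI[of _ "b*c"]) (simp add: Const_mult mult.assoc)
next
  case (2 x)
  then obtain b where "x = Const b * f" "b \<noteq> 0" by blast
  with \<open>c \<noteq> 0\<close> show ?case
    by (intro CollectI exI[of _ "b/c"]) (simp add: mult.assoc[symmetric] Const_mult[symmetric])
qed

lemma hessian_map_proj_class: "hessian_map r (proj_class f) = proj_class (hess r f)"
proof -
  have "hessian_map r (proj_class f) = (\<Union>c\<in>{c. c \<noteq> 0}. proj_class (hess r (Const c * f)))"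
    by (auto simp: hessian_map_def proj_class_def[of f])
  also have "\<dots> = (\<Union>c\<in>{c::'a. c \<noteq> 0}. proj_class (hess r f))"
    by (intro SUP_cong refl) (simp add: hess_Const_mult proj_class_Const del: power_Suc)
  also have "\<dots> = proj_class (hess r f)"
    using one_neq_zero by blast
  finally show ?thesis .
qed

lemma tangent_vector_Const:
  assumes "a \<noteq> 0"
  shows "tangent_vector (Const a * f) (Const a * g + Const b * f) = tangent_vector f g"
proof -
  have 1: "tangent_vector (Const a * f) (Const a * g + Const b * f) \<subseteq> tangent_vector f g"
    if "a \<noteq> 0" for f g and a b :: 'a
  proof
    fix x assume "x \<in> tangent_vector (Const a * f) (Const a * g + Const b * f)"
    then obtain c e where x: "c \<noteq> 0"
        "x = (Const c * (Const a * f), Const c * (Const a * g + Const b * f) + Const e * (Const a * f))"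
      by (auto simp: tangent_vector_def)
    have "x = (Const (c*a) * f, Const (c*a) * g + Const (c*b+e*a) * f)"
      unfolding x prod.inject
      by (intro conjI poly_mapping_eqI; simp only: lookup_add lookup_Const_mult; simp only: algebra_simps)
    with x(1) that show "x \<in> tangent_vector f g"
      unfolding tangent_vector_def by fastforce
  qed
  have 2: "Const (1/a) * (Const a * f) = f"
    using assms by (simp add: mult.assoc[symmetric] Const_mult[symmetric] Const_1)
  have 3: "Const (1/a) * (Const a * g + Const b * f) + Const (- b / a^2) * (Const a * f) = g"
    using assms
    by (intro poly_mapping_eqI, simp only: lookup_add lookup_Const_mult)
      (simp add: field_simps power2_eq_square)
  from 1[of "1/a" "Const a * f" "Const a * g + Const b * f" "-b/a^2"] assms
  have "tangent_vector f g \<subseteq> tangent_vector (Const a * f) (Const a * g + Const b * f)"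
    unfolding 2 3 by simp
  with 1[OF assms] show ?thesis by blast
qed

lemma tangent_vector_eq_iff:
  assumes "f \<noteq> 0"
  shows "tangent_vector f g = tangent_vector f g' \<longleftrightarrow> (\<exists>c. g' = g + Const c * f)"
proof
  assume "tangent_vector f g = tangent_vector f g'"
  moreover have "(f, g') \<in> tangent_vector f g'"
    unfolding tangent_vector_def
    by (intro CollectI exI[of _ 1] exI[of _ 0]) (simp add: Const_1 Const_0)
  ultimately obtain a b where a: "f = Const a * f" and g': "g' = Const a * g + Const b * f"
    unfolding tangent_vector_def by blast
  from assms obtain m where m: "Poly_Mapping.lookup f m \<noteq> 0"
    by (metis poly_mapping_eqI lookup_zero)
  have "Poly_Mapping.lookup f m = a * Poly_Mapping.lookup f m"
    by (subst a) (simp add: lookup_Const_mult)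
  with m have "a = 1" by simp
  with g' show "\<exists>c. g' = g + Const c * f" by (auto simp: Const_1)
next
  assume "\<exists>c. g' = g + Const c * f"
  then obtain c where "g' = g + Const c * f" ..
  then show "tangent_vector f g = tangent_vector f g'"
    using tangent_vector_Const[of 1 f g c] by (simp add: Const_1)
qed

lemma lookup_map_zero:
  "\<phi> 0 = 0 \<Longrightarrow> Poly_Mapping.lookup (Poly_Mapping.map \<phi> p) m = \<phi> (Poly_Mapping.lookup p m)"
  by (simp add: map.rep_eq when_def)

lemma map_const_mult:
  fixes p q :: "('v, 'a::field) mpoly"
  shows "Poly_Mapping.map (\<lambda>c. [:c:]) (p * q) =
    Poly_Mapping.map (\<lambda>c. [:c:]) p * Poly_Mapping.map (\<lambda>c. [:c:]) q"
proof -
  define L :: "('v, 'a) mpoly \<Rightarrow> ('v, 'a poly) mpoly" where "L = Poly_Mapping.map (\<lambda>c. [:c:])"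
  have L_add: "L (p + q) = L p + L q" for p q
    by (rule poly_mapping_eqI) (simp add: L_def lookup_map_zero lookup_add)
  have L_0: "L 0 = 0"
    by (rule poly_mapping_eqI) (simp add: L_def lookup_map_zero)
  have L_sum: "L (\<Sum>x\<in>A. h x) = (\<Sum>x\<in>A. L (h x))" for A and h :: "('v \<Rightarrow>\<^sub>0 nat) \<Rightarrow> ('v, 'a) mpoly"
    by (induction A rule: infinite_finite_induct) (simp_all add: L_add L_0)
  have L_single: "L (Poly_Mapping.single m c) = Poly_Mapping.single m [:c:]" for m c
    by (rule poly_mapping_eqI) (simp add: L_def lookup_map_zero lookup_single when_def)
  have sum_single: "p = (\<Sum>m\<in>Poly_Mapping.keys p. Poly_Mapping.single m (Poly_Mapping.lookup p m))"
    for p :: "('v, 'a) mpoly"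
    by (rule poly_mapping_eqI) (simp add: lookup_sum lookup_single when_def in_keys_iff)
  have 1: "L (Poly_Mapping.single m c * q) = L (Poly_Mapping.single m c) * L q" for m c q
  proof -
    have "Poly_Mapping.single m c * q =
        (\<Sum>m'\<in>Poly_Mapping.keys q. Poly_Mapping.single (m + m') (c * Poly_Mapping.lookup q m'))"
      by (subst sum_single[of q]) (simp add: sum_distrib_left mult_single)
    then have "L (Poly_Mapping.single m c * q) =
        (\<Sum>m'\<in>Poly_Mapping.keys q. L (Poly_Mapping.single m c) * L (Poly_Mapping.single m' (Poly_Mapping.lookup q m')))"
      by (simp add: L_sum L_single mult_single mult.commute)
    also have "\<dots> = L (Poly_Mapping.single m c) * L q"
      by (subst (2) sum_single[of q]) (simp add: L_sum sum_distrib_left)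
    finally show ?thesis .
  qed
  have "L (p * q) = (\<Sum>m\<in>Poly_Mapping.keys p. L (Poly_Mapping.single m (Poly_Mapping.lookup p m)) * L q)"
    by (subst sum_single[of p]) (simp add: sum_distrib_right L_sum 1)
  also have "\<dots> = L p * L q"
    by (subst (2) sum_single[of p]) (simp add: L_sum sum_distrib_right)
  finally show ?thesis by (simp add: L_def)
qed

lemma hess_map_const:
  fixes f :: "'a::field poly_x"
  shows "hess r (Poly_Mapping.map (\<lambda>c. [:c:]) f) = Poly_Mapping.map (\<lambda>c. [:c:]) (hess r f)"
proof -
  interpret L: comm_ring_hom "Poly_Mapping.map (\<lambda>c. [:c:]) :: 'a poly_x \<Rightarrow> 'a poly poly_x"
    by unfold_locales
      (auto intro!: poly_mapping_eqI simp: lookup_map_zero lookup_add map_const_mult lookup_one when_def)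
  have P: "partial i (Poly_Mapping.map (\<lambda>c. [:c:]) p) = Poly_Mapping.map (\<lambda>c. [:c:]) (partial i p)"
    for i and p :: "'a poly_x"
    by (rule poly_mapping_eqI) (simp add: lookup_partial lookup_map_zero of_nat_poly algebra_simps)
  show ?thesis
    unfolding hess_def
    by (subst L.hom_det[symmetric], rule arg_cong[of _ _ Determinant.det], rule eq_matI) (auto simp: P)
qed

lemma prod_dvd_diff:
  fixes s :: "'a::comm_ring_1"
  assumes "\<And>i. i \<in> A \<Longrightarrow> s dvd a i - b i"
  shows "s dvd prod a A - prod b A"
  using assms
proof (induction A rule: infinite_finite_induct)
  case (insert x A)
  have "prod a (insert x A) - prod b (insert x A) =
      (a x - b x) * prod a A + b x * (prod a A - prod b A)"
    using insert by (simp add: algebra_simps)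
  moreover have "s dvd a x - b x" "s dvd prod a A - prod b A"
    using insert by simp_all
  ultimately show ?case by simp
qed auto

lemma det_dvd_diff:
  fixes s :: "'a::comm_ring_1"
  assumes "\<And>i j. i < n \<Longrightarrow> j < n \<Longrightarrow> s dvd a i j - b i j"
  shows "s dvd Determinant.det (Matrix.mat n n (\<lambda>(i,j). a i j)) -
    Determinant.det (Matrix.mat n n (\<lambda>(i,j). b i j))"
proof -
  have "s dvd signof p * (\<Prod>i = 0..<n. a i (p i)) - signof p * (\<Prod>i = 0..<n. b i (p i))"
    if "p permutes {0..<n}" for p
  proof -
    have "s dvd (\<Prod>i = 0..<n. a i (p i)) - (\<Prod>i = 0..<n. b i (p i))"
    proof (rule prod_dvd_diff)
      fix i assume "i \<in> {0..<n}"
      moreover from this have "p i \<in> {0..<n}" using permutes_in_image[OF that] by blast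
      ultimately show "s dvd a i (p i) - b i (p i)" by (intro assms) auto
    qed
    then show ?thesis
      unfolding right_diff_distrib[symmetric] by (rule dvd_mult)
  qed
  then have "s dvd (\<Sum>p | p permutes {0..<n}. signof p * (\<Prod>i = 0..<n. a i (p i))) -
      (\<Sum>p | p permutes {0..<n}. signof p * (\<Prod>i = 0..<n. b i (p i)))"
    unfolding sum_subtractf[symmetric] by (intro dvd_sum) blast
  moreover have "Determinant.det (Matrix.mat n n (\<lambda>(i,j). c i j)) =
      (\<Sum>p | p permutes {0..<n}. signof p * (\<Prod>i = 0..<n. c i (p i)))" for c :: "nat \<Rightarrow> nat \<Rightarrow> 'a"
  proof -
    have "(\<Prod>i = 0..<n. Matrix.mat n n (\<lambda>(i,j). c i j) $$ (i, p i)) = (\<Prod>i = 0..<n. c i (p i))"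
      if "p permutes {0..<n}" for p
    proof (rule prod.cong[OF refl])
      fix i assume "i \<in> {0..<n}"
      moreover from this have "p i \<in> {0..<n}" using permutes_in_image[OF that] by blast
      ultimately show "Matrix.mat n n (\<lambda>(i,j). c i j) $$ (i, p i) = c i (p i)" by simp
    qed
    then show ?thesis by (simp add: Determinant.det_def)
  qed
  ultimately show ?thesis by simp
qed

lemma hess_dvd_diff:
  assumes "Const s dvd p - q"
  shows "Const s dvd hess r p - hess r q"
proof -
  have P: "Const s dvd partial i p - partial i q" if dvd: "Const s dvd p - q" for i p q
  proof -
    from dvd obtain u where "p - q = Const s * u" ..
    then have "p = q + Const s * u" by (simp add: algebra_simps)
    then show ?thesis by (simp add: partial_add partial_Const_mult)
  qed
  show ?thesis
    unfolding hess_def by (intro det_dvd_diff P assms)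
qed

lemma Const_dvd_lookup: "Const s dvd p - q \<Longrightarrow> s dvd Poly_Mapping.lookup p m - Poly_Mapping.lookup q m"
proof -
  assume "Const s dvd p - q"
  then obtain u where "p - q = Const s * u" ..
  then have "Poly_Mapping.lookup (p - q) m = s * Poly_Mapping.lookup u m"
    by (simp only: lookup_Const_mult)
  then show ?thesis by (simp add: lookup_minus)
qed

lemma coeff_eq_if_dvd:
  fixes p q :: "'a::field poly"
  assumes "monom 1 n dvd p - q" "k < n"
  shows "coeff p k = coeff q k"
proof -
  from assms(1) obtain u where "p - q = monom 1 n * u" ..
  then have "coeff (p - q) k = coeff (monom 1 n * u) k" by simp
  with assms(2) show ?thesis by (simp add: coeff_monom_mult)
qed

lemma hess_pencil_coeff_0:
  "coeff (Poly_Mapping.lookup (hess r (pencil f g)) m) 0 = Poly_Mapping.lookup (hess r f) m"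
proof -
  have "pencil f g - Poly_Mapping.map (\<lambda>c. [:c:]) f = Const (monom 1 1) * Poly_Mapping.map (\<lambda>c. [:c:]) g"
    by (rule poly_mapping_eqI)
      (simp add: pencil_def lookup_minus lookup_add lookup_map_zero lookup_Const_mult monom_altdef)
  then have "monom 1 1 dvd Poly_Mapping.lookup (hess r (pencil f g)) m -
      Poly_Mapping.lookup (hess r (Poly_Mapping.map (\<lambda>c. [:c:]) f)) m"
    by (intro Const_dvd_lookup hess_dvd_diff) simp
  from coeff_eq_if_dvd[OF this, of 0] show ?thesis
    by (simp add: hess_map_const lookup_map_zero)
qed

lemma hess_deriv_rescale:
  assumes a: "a \<noteq> 0"
  shows "\<exists>b'. hess_deriv r (Const a * f) (Const a * g + Const b * f) =
    Const (a ^ (r+1)) * hess_deriv r f g + Const b' * hess r f"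
proof (intro exI poly_mapping_eqI)
  fix m
  let ?u = "[:a, b:]"
  let ?H = "Poly_Mapping.lookup (hess r (pencil f g)) m"
  have "Const ?u * pencil f g - pencil (Const a * f) (Const a * g + Const b * f) =
      Const (monom 1 2) * (Const [:b:] * Poly_Mapping.map (\<lambda>c. [:c:]) g)"
    by (rule poly_mapping_eqI, simp only: pencil_def lookup_minus lookup_add lookup_Const_mult)
      (simp add: lookup_map_zero lookup_add lookup_Const_mult monom_altdef power2_eq_square)
  then have "monom 1 2 dvd Poly_Mapping.lookup (hess r (Const ?u * pencil f g)) m -
      Poly_Mapping.lookup (hess r (pencil (Const a * f) (Const a * g + Const b * f))) m"
    by (intro Const_dvd_lookup hess_dvd_diff) simp
  from coeff_eq_if_dvd[OF this, of 1]
  have "coeff (Poly_Mapping.lookup (hess r (pencil (Const a * f) (Const a * g + Const b * f))) m) 1 =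
      coeff (?u ^ (r+1) * ?H) 1"
    by (simp add: hess_Const_mult lookup_Const_mult del: power_Suc)
  also have "\<dots> = a ^ (r+1) * coeff ?H 1 + coeff (?u ^ (r+1)) 1 * coeff ?H 0"
  proof -
    have "coeff (?u ^ (r+1)) 0 = a ^ (r+1)"
      by (simp add: coeff_0_power del: power_Suc)
    then show ?thesis
      by (simp add: coeff_mult del: power_Suc)
  qed
  finally show "Poly_Mapping.lookup (hess_deriv r (Const a * f) (Const a * g + Const b * f)) m =
    Poly_Mapping.lookup (Const (a ^ (r+1)) * hess_deriv r f g + Const (coeff (?u ^ (r+1)) 1) * hess r f) m"
    by (simp add: hess_deriv_def lookup_map_zero lookup_add lookup_Const_mult hess_pencil_coeff_0
        del: power_Suc)
qed

lemma hessian_differential_tangent_vector: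
  "hessian_differential r (tangent_vector f g) = tangent_vector (hess r f) (hess_deriv r f g)"
proof -
  have "tangent_vector (hess r (Const a * f)) (hess_deriv r (Const a * f) (Const a * g + Const b * f)) =
      tangent_vector (hess r f) (hess_deriv r f g)" if "a \<noteq> 0" for a b
  proof -
    from hess_deriv_rescale[OF that, of r f g b] obtain b' where
      "hess_deriv r (Const a * f) (Const a * g + Const b * f) =
        Const (a ^ (r+1)) * hess_deriv r f g + Const b' * hess r f" ..
    with that show ?thesis
      by (simp add: hess_Const_mult tangent_vector_Const del: power_Suc)
  qed
  then have "tangent_vector (hess r p) (hess_deriv r p q) = tangent_vector (hess r f) (hess_deriv r f g)"
    if "(p, q) \<in> tangent_vector f g" for p q
    using that unfolding tangent_vector_def[of f g] by blast
  moreover have "(f, g) \<in> tangent_vector f g"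
    unfolding tangent_vector_def
    by (intro CollectI exI[of _ 1] exI[of _ 0]) (simp add: Const_1 Const_0)
  ultimately show ?thesis
    unfolding hessian_differential_def by blast
qed

end

theory Submission
  imports Defs
begin

text \<open>Write \<open>e = d - 2\<close>, \<open>y\<^sub>i = l\<^sub>i ^ e\<close> and let \<open>g\<^sub>i\<^sub>j\<close> be the second partial derivatives of \<open>g\<close>.
  The Hessian matrix of \<open>f\<close> is a multiple of the diagonal matrix with entries \<open>y\<^sub>0, \<dots>, y\<^sub>r\<close> plus
  the constant matrix \<open>z = y\<^sub>r\<^sub>+\<^sub>1\<close>, so its adjugate is explicit and the derivative of \<open>hess\<close> at \<open>f\<close> in
  direction \<open>g\<close> vanishes iff
  \<open>\<Sum>\<^sub>i (\<Prod>\<^sub>k\<^sub>\<noteq>\<^sub>i y\<^sub>k) g\<^sub>i\<^sub>i + z \<Sum>\<^sub>i\<^sub><\<^sub>j (\<Prod>\<^sub>k\<^sub>\<noteq>\<^sub>i\<^sub>,\<^sub>j y\<^sub>k) (g\<^sub>i\<^sub>i + g\<^sub>j\<^sub>j - 2 g\<^sub>i\<^sub>j) = 0\<close>.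
  Reducing modulo the ideals \<open>(y\<^sub>i, y\<^sub>j)\<close> and then \<open>(y\<^sub>i)\<close>, modulo which the other factors can be cancelled,
  shows that \<open>g\<^sub>i\<^sub>i + g\<^sub>j\<^sub>j - 2 g\<^sub>i\<^sub>j\<close> is a combination of \<open>y\<^sub>i\<close> and \<open>y\<^sub>j\<close>, and \<open>g\<^sub>i\<^sub>i\<close> one of \<open>y\<^sub>i\<close> and \<open>z\<close>.
  Comparing coefficients, all of these are the second derivatives of a combination of the \<open>l\<^sub>i ^ d\<close>,
  and inserting this into the equation gives \<open>g = 0\<close>. Injectivity modulo \<open>f\<close> follows by Euler's relation
  between \<open>hess\<close> and its derivative in direction \<open>f\<close>.

  For the general point: injectivity is the nonvanishing of a determinant that is a form in the coefficients,
  hence holds on a Zariski open neighbourhood of \<open>f\<close>. It fails for every sum of \<open>r + 1\<close> powers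
  \<open>l\<^sub>0 ^ d + \<dots> + l\<^sub>r ^ d\<close>, in direction \<open>l\<^sub>0 ^ d - l\<^sub>1 ^ d\<close>; so a sum of \<open>r + 2\<close> powers at which it holds has
  rank exactly \<open>r + 2\<close>. Joining any form of rank \<open>r + 2\<close> to \<open>f\<close> by a polynomial curve of sums of \<open>r + 2\<close>
  powers then proves density.\<close>

section \<open>Polynomials as finitely supported functions\<close>

abbreviation "lookup \<equiv> Poly_Mapping.lookup"
abbreviation "keys \<equiv> Poly_Mapping.keys"
abbreviation "single \<equiv> Poly_Mapping.single"

lemma poly_mapping_sum_single: "p = (\<Sum>m\<in>keys p. single m (lookup p m))"
  by (rule poly_mapping_eqI) (simp add: lookup_sum lookup_single when_def in_keys_iff)

text \<open>Additive statements need only be checked on single terms; applied to both factors it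
  proves the product rule and the multiplicativity of evaluation.\<close>

lemma poly_mapping_single_induct [case_names single add]:
  fixes P :: "('a \<Rightarrow>\<^sub>0 'b::comm_monoid_add) \<Rightarrow> bool"
  assumes "\<And>m c. P (single m c)" and add: "\<And>p q. P p \<Longrightarrow> P q \<Longrightarrow> P (p + q)"
  shows "P p"
proof -
  have "P (\<Sum>m\<in>A. single m (lookup p m))" if "finite A" for A
    using that
  proof induction
    case empty
    then show ?case using assms(1)[of undefined 0] by simp
  next
    case (insert x F)
    then show ?case by (simp add: assms)
  qed
  then show ?thesis by (subst poly_mapping_sum_single) simp
qed

lemma lookup_single_mult:
  fixes p :: "('a::cancel_comm_monoid_add) \<Rightarrow>\<^sub>0 ('b::comm_semiring_1)"
  shows "lookup (single a c * p) (a + m) = c * lookup p m"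
  by (simp add: lookup_mult lookup_single when_mult)

lemma lookup_single_mult_0:
  fixes p :: "('a::cancel_comm_monoid_add) \<Rightarrow>\<^sub>0 ('b::comm_semiring_1)"
  assumes "\<nexists>b. m = a + b"
  shows "lookup (single a c * p) m = 0"
  using assms by (auto simp: lookup_mult lookup_single when_mult)

lemma finite_bounded_poly_mappings:
  assumes "finite A"
  shows "finite {m :: 'v \<Rightarrow>\<^sub>0 nat. keys m \<subseteq> A \<and> (\<forall>v. lookup m v \<le> N)}" (is "finite ?S")
proof -
  have "finite {f. \<forall>x. (x \<in> A \<longrightarrow> f x \<in> {..N}) \<and> (x \<notin> A \<longrightarrow> f x = (0::nat))}"
    using assms by (intro finite_set_of_finite_funs) auto
  then have "finite (lookup ` ?S)"
    by (rule rev_finite_subset) (auto simp: in_keys_iff)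
  then show ?thesis
    by (rule finite_imageD) (auto intro!: inj_onI poly_mapping_eqI)
qed

lemma finite_divisors: "finite {a :: 'v \<Rightarrow>\<^sub>0 nat. \<exists>b. m = a + b}"
proof (rule finite_subset)
  show "{a. \<exists>b. m = a + b} \<subseteq> {a. keys a \<subseteq> keys m \<and> (\<forall>v. lookup a v \<le> (\<Sum>v\<in>keys m. lookup m v))}"
  proof safe
    fix a b v
    assume m: "m = a + b"
    show "lookup a v \<le> (\<Sum>v\<in>keys (a + b). lookup (a + b) v)"
    proof (cases "v \<in> keys (a + b)")
      case True
      then have "lookup (a + b) v \<le> (\<Sum>v\<in>keys (a + b). lookup (a + b) v)"
        by (intro member_le_sum) auto
      then show ?thesis by (simp add: lookup_add)
    next
      case False
      then show ?thesis by (simp add: in_keys_iff lookup_add)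
    qed
  qed (auto simp: in_keys_iff lookup_add)
qed (simp add: finite_bounded_poly_mappings)

text \<open>The convolution runs over the divisors of \<open>m\<close>, a finite set that depends on
  neither factor. Hence it stays the same when the factors vary in a family or are mapped
  coefficientwise.\<close>

lemma lookup_mult_sum:
  fixes p q :: "('v, 'a::comm_ring_1) mpoly"
  shows "lookup (p * q) m = (\<Sum>a | \<exists>b. m = a + b. lookup p a * lookup q (m - a))"
proof -
  have "lookup (p * q) m = (\<Sum>a\<in>keys p. lookup (single a (lookup p a) * q) m)"
    by (subst (1) poly_mapping_sum_single[of p]) (simp add: sum_distrib_right lookup_sum)
  also have "\<dots> = (\<Sum>a\<in>keys p \<union> {a. \<exists>b. m = a + b}. lookup (single a (lookup p a) * q) m)"
    by (rule sum.mono_neutral_left) (auto simp: finite_divisors in_keys_iff)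
  also have "\<dots> = (\<Sum>a | \<exists>b. m = a + b. lookup (single a (lookup p a) * q) m)"
    by (rule sum.mono_neutral_right) (auto simp: finite_divisors lookup_single_mult_0)
  also have "\<dots> = (\<Sum>a | \<exists>b. m = a + b. lookup p a * lookup q (m - a))"
    by (rule sum.cong) (auto simp: lookup_single_mult)
  finally show ?thesis .
qed

section \<open>Formal partial derivatives\<close>

lemma partial_0 [simp]: "partial i 0 = 0"
  by (simp add: partial_def)

lemma partial_sum: "partial i (\<Sum>x\<in>A. h x) = (\<Sum>x\<in>A. partial i (h x))"
  by (induction A rule: infinite_finite_induct) (simp_all add: partial_add)

lemma partial_diff: "partial i (p - q) = partial i p - partial i q"
  by (rule poly_mapping_eqI) (simp add: lookup_partial lookup_minus algebra_simps)

lemma partial_single: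
  "partial i (single m c) = single (m - single i 1) (of_nat (lookup m i) * c)"
  by (cases "c = 0") (simp_all add: partial_def)

lemma partial_mult: "partial i (p * q) = partial i p * q + p * partial i q"
proof (induction p rule: poly_mapping_single_induct)
  case (single m c)
  show ?case
  proof (induction q rule: poly_mapping_single_induct)
    case (single n e)
    \<comment> \<open>The truncating subtraction is exact when the exponent at \<open>i\<close> is
      positive; when it is 0, the coefficient of the derivative vanishes.\<close>
    have "m - single i 1 + n = m + n - single i 1" if "lookup m i \<noteq> 0" for m n :: "'a \<Rightarrow>\<^sub>0 nat"
    proof (rule poly_mapping_eqI)
      fix k show "lookup (m - single i 1 + n) k = lookup (m + n - single i 1) k"
        using that by (cases "k = i") (simp_all add: lookup_add lookup_minus lookup_single)
    qed
    from this[of m n] this[of n m] show ?case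
      by (cases "lookup m i = 0"; cases "lookup n i = 0")
        (simp_all add: partial_single mult_single lookup_add single_add[symmetric] algebra_simps)
  qed (simp add: algebra_simps partial_add)
qed (simp add: algebra_simps partial_add)

lemma partial_Const [simp]: "partial i (Const c) = 0"
  by (simp add: Const_def partial_single)

lemma partial_power: "partial i (p ^ Suc n) = of_nat (Suc n) * p ^ n * partial i p"
  by (induction n) (simp_all add: partial_mult algebra_simps)

lemma partial_Var: "partial i (Var j) = (if i = j then 1 else 0)"
  by (simp add: Var_def partial_single lookup_single when_def)

lemma partial_commute: "partial i (partial j p) = partial j (partial i p)"
  by (rule poly_mapping_eqI) (auto simp: lookup_partial lookup_add lookup_single when_def algebra_simps)

lemma Const_add: "Const (a + b) = Const a + Const b"
  by (simp add: Const_def single_add)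

lemma Const_uminus: "Const (- a) = - Const a"
  by (simp add: Const_def single_uminus)

lemma Const_sum: "Const (\<Sum>x\<in>A. h x) = (\<Sum>x\<in>A. Const (h x))"
  by (induction A rule: infinite_finite_induct) (simp_all add: Const_add Const_0)

lemma Const_of_nat: "Const (of_nat n) = of_nat n"
  by (simp add: Const_def)

lemma Const_eq_0_iff [simp]: "Const c = 0 \<longleftrightarrow> c = 0"
  by (metis Const_def lookup_single_eq lookup_zero single_zero)

section \<open>Degrees of monomials and spaces of forms\<close>

lemma mon_degree_sum:
  assumes "finite A" "keys m \<subseteq> A"
  shows "mon_degree m = (\<Sum>i\<in>A. lookup m i)"
  unfolding mon_degree_def using assms by (intro sum.mono_neutral_left) (auto simp: in_keys_iff)

lemma mon_degree_add: "mon_degree (m + n) = mon_degree m + mon_degree n"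
proof -
  have "keys (m + n) \<subseteq> keys m \<union> keys n" by (rule keys_add)
  then show ?thesis
    using mon_degree_sum[of "keys m \<union> keys n" m] mon_degree_sum[of "keys m \<union> keys n" n]
      mon_degree_sum[of "keys m \<union> keys n" "m + n"]
    by (simp add: lookup_add sum.distrib)
qed

lemma mon_degree_single [simp]: "mon_degree (single i n) = n"
  by (simp add: mon_degree_def)

lemma mon_degree_0 [simp]: "mon_degree 0 = 0"
  by (simp add: mon_degree_def)

lemma homogeneous_mult: "homogeneous d p \<Longrightarrow> homogeneous e q \<Longrightarrow> homogeneous (d + e) (p * q)"
  using keys_mult[of p q] by (fastforce simp: homogeneous_def mon_degree_add)

lemma homogeneous_add: "homogeneous d p \<Longrightarrow> homogeneous d q \<Longrightarrow> homogeneous d (p + q)"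
  using keys_add[of p q] by (auto simp: homogeneous_def)

lemma homogeneous_Const: "homogeneous 0 (Const c)"
  by (simp add: homogeneous_def Const_def)

lemma homogeneous_Var: "homogeneous 1 (Var v)"
  by (simp add: homogeneous_def Var_def)

lemma forms_iff: "p \<in> forms d r \<longleftrightarrow> (\<forall>m. lookup p m \<noteq> 0 \<longrightarrow> mon_degree m = d \<and> keys m \<subseteq> {..r})"
  by (auto simp: forms_def homogeneous_def in_keys_iff)

lemma zero_in_forms [simp]: "0 \<in> forms d r"
  by (simp add: forms_iff)

lemma forms_add: "p \<in> forms d r \<Longrightarrow> q \<in> forms d r \<Longrightarrow> p + q \<in> forms d r"
  unfolding forms_iff lookup_add by (metis add_0)

lemma forms_Const_mult: "p \<in> forms d r \<Longrightarrow> Const c * p \<in> forms d r"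
  by (simp add: forms_iff lookup_Const_mult) (metis mult_zero_right)

lemma forms_diff: "p \<in> forms d r \<Longrightarrow> q \<in> forms d r \<Longrightarrow> p - q \<in> forms d r"
  using forms_add[of p d r "Const (-1) * q"] forms_Const_mult[of q d r "-1"]
  by (simp add: Const_uminus Const_1)

lemma forms_sum: "(\<And>x. x \<in> A \<Longrightarrow> h x \<in> forms d r) \<Longrightarrow> (\<Sum>x\<in>A. h x) \<in> forms d r"
  by (induction A rule: infinite_finite_induct) (auto intro: forms_add)

lemma forms_mult:
  assumes "p \<in> forms d r" "q \<in> forms e r"
  shows "p * q \<in> forms (d + e) r"
proof -
  have "keys m \<subseteq> {..r}" if m: "m \<in> keys (p * q)" for m
  proof -
    from m keys_mult[of p q] obtain a b where "m = a + b" "a \<in> keys p" "b \<in> keys q" by blast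
    moreover from this have "keys a \<subseteq> {..r}" "keys b \<subseteq> {..r}"
      using assms by (auto simp: forms_def)
    ultimately show ?thesis using keys_add[of a b] by blast
  qed
  then show ?thesis
    using assms homogeneous_mult[of d p e q] by (auto simp: forms_def)
qed

lemma one_in_forms: "1 \<in> forms 0 r"
  by (simp add: forms_def homogeneous_def)

lemma forms_power: "p \<in> forms d r \<Longrightarrow> p ^ n \<in> forms (d * n) r"
  by (induction n) (auto simp: one_in_forms intro: forms_mult)

lemma Var_in_forms: "i \<le> r \<Longrightarrow> Var i \<in> forms 1 r"
  by (auto simp: forms_iff Var_def lookup_single when_def)

lemma finite_forms_monomials: "finite {m :: nat \<Rightarrow>\<^sub>0 nat. mon_degree m = d \<and> keys m \<subseteq> {..r}}"
proof (rule finite_subset)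
  show "{m :: nat \<Rightarrow>\<^sub>0 nat. mon_degree m = d \<and> keys m \<subseteq> {..r}} \<subseteq>
      {m. keys m \<subseteq> {..r} \<and> (\<forall>v. lookup m v \<le> d)}"
  proof safe
    fix m :: "nat \<Rightarrow>\<^sub>0 nat" and v
    show "lookup m v \<le> mon_degree m"
      unfolding mon_degree_def
      by (cases "v \<in> keys m") (auto intro: member_le_sum simp: in_keys_iff)
  qed
qed (simp add: finite_bounded_poly_mappings)

lemma partial_in_forms:
  assumes "p \<in> forms (Suc d) r"
  shows "partial i p \<in> forms d r"
  unfolding forms_iff
proof (intro allI impI)
  fix m assume "lookup (partial i p) m \<noteq> 0"
  then have "lookup p (m + single i 1) \<noteq> 0"
    by (metis lookup_partial mult_zero_right)
  with assms have "mon_degree (m + single i 1) = Suc d" "keys (m + single i 1) \<subseteq> {..r}"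
    by (auto simp: forms_iff)
  moreover have "keys m \<subseteq> keys (m + single i 1)"
    by (auto simp: in_keys_iff lookup_add)
  ultimately show "mon_degree m = d \<and> keys m \<subseteq> {..r}"
    by (auto simp: mon_degree_add)
qed

section \<open>The derivative of the determinant\<close>

lemma det_mat_eq:
  fixes a :: "nat \<Rightarrow> nat \<Rightarrow> 'a::comm_ring_1"
  shows "Determinant.det (Matrix.mat n n (\<lambda>(i,j). a i j)) =
    (\<Sum>p | p permutes {0..<n}. signof p * (\<Prod>i = 0..<n. a i (p i)))"
proof -
  have "(\<Prod>i = 0..<n. Matrix.mat n n (\<lambda>(i,j). a i j) $$ (i, p i)) = (\<Prod>i = 0..<n. a i (p i))"
    if "p permutes {0..<n}" for p
  proof (rule prod.cong[OF refl])
    fix i assume "i \<in> {0..<n}"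
    moreover from this have "p i \<in> {0..<n}" using permutes_in_image[OF that] by blast
    ultimately show "Matrix.mat n n (\<lambda>(i,j). a i j) $$ (i, p i) = a i (p i)" by simp
  qed
  then show ?thesis by (simp add: Determinant.det_def)
qed

text \<open>The derivative of \<open>det\<close> at \<open>A\<close> in direction \<open>B\<close>.\<close>

definition ddet :: "nat \<Rightarrow> (nat \<Rightarrow> nat \<Rightarrow> 'a::comm_ring_1) \<Rightarrow> (nat \<Rightarrow> nat \<Rightarrow> 'a) \<Rightarrow> 'a" where
  "ddet n A B = (\<Sum>p | p permutes {0..<n}. signof p *
     (\<Sum>i = 0..<n. B i (p i) * (\<Prod>j\<in>{0..<n} - {i}. A j (p j))))"

text \<open>The pair \<open>c0, c1\<close> reads off the first two coefficients of a power series; it is used both for the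
  coefficients in \<open>R[t]\<close> and for polynomials over \<open>k[t]\<close>.\<close>

lemma first_order_prod:
  fixes c0 c1 :: "'a::comm_ring_1 \<Rightarrow> 'b::comm_ring_1"
  assumes "c0 1 = 1" "\<And>x y. c0 (x * y) = c0 x * c0 y"
    and "c1 1 = 0" "\<And>x y. c1 (x * y) = c1 x * c0 y + c0 x * c1 y" "finite S"
  shows "c1 (\<Prod>i\<in>S. a i) = (\<Sum>i\<in>S. c1 (a i) * (\<Prod>j\<in>S - {i}. c0 (a j)))"
  using \<open>finite S\<close>
proof induction
  case (insert x S)
  have c0_prod: "c0 (prod a S) = (\<Prod>j\<in>S. c0 (a j))"
    using insert(1) by induction (simp_all add: assms)
  have "c1 (a i) * (\<Prod>j\<in>insert x S - {i}. c0 (a j)) =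
      c0 (a x) * (c1 (a i) * (\<Prod>j\<in>S - {i}. c0 (a j)))" if "i \<in> S" for i
  proof -
    have "insert x S - {i} = insert x (S - {i})" using that insert by auto
    then show ?thesis using insert by (simp add: algebra_simps)
  qed
  then have "(\<Sum>i\<in>S. c1 (a i) * (\<Prod>j\<in>insert x S - {i}. c0 (a j))) = c0 (a x) * c1 (prod a S)"
    using insert by (simp add: sum_distrib_left)
  moreover have "insert x S - {x} = S" using insert by auto
  ultimately show ?case using insert by (simp add: assms c0_prod)
qed (simp add: assms)

lemma first_order_det:
  fixes c0 c1 :: "'a::comm_ring_1 \<Rightarrow> 'b::comm_ring_1"
  assumes "c0 1 = 1" "\<And>x y. c0 (x * y) = c0 x * c0 y"
    and "c1 1 = 0" "\<And>x y. c1 (x * y) = c1 x * c0 y + c0 x * c1 y"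
    and add: "\<And>x y. c1 (x + y) = c1 x + c1 y"
  shows "c1 (Determinant.det (Matrix.mat n n (\<lambda>(i,j). a i j))) =
    ddet n (\<lambda>i j. c0 (a i j)) (\<lambda>i j. c1 (a i j))"
proof -
  have zero: "c1 0 = 0" using add[of 0 0] by simp
  have minus: "c1 (- x) = - c1 x" for x
    using add[of x "- x"] zero by (simp add: eq_neg_iff_add_eq_0 add.commute)
  have sum: "c1 (\<Sum>x\<in>S. h x) = (\<Sum>x\<in>S. c1 (h x))" for S and h :: "(nat \<Rightarrow> nat) \<Rightarrow> 'a"
    by (induction S rule: infinite_finite_induct) (simp_all add: add zero)
  have sgn: "c1 (signof p * x) = signof p * c1 x" for p x
    by (cases rule: sign_cases[of p]) (simp_all add: minus)
  show ?thesis
    unfolding det_mat_eq sum sgn ddet_def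
    by (intro sum.cong refl arg_cong[of _ _ "\<lambda>x. signof _ * x"] first_order_prod assms) simp
qed

text \<open>Through this, identities of determinants over \<open>R[t]\<close> become identities for
  \<open>ddet\<close>.\<close>

lemma coeff_1_det:
  "coeff (Determinant.det (Matrix.mat n n (\<lambda>(i,j). [:A i j, B i j:]))) 1 = ddet n A B"
  by (subst first_order_det[where ?c0.0 = "\<lambda>p. coeff p 0" and ?c1.0 = "\<lambda>p. coeff p 1"])
    (simp_all add: coeff_mult)

text \<open>Reading off the coefficients of \<open>1\<close> and \<open>t\<close> inside every
  coefficient commutes with partial derivatives and obeys the rules required by
  \<open>first_order_det\<close>; applied to the pencil it returns the second derivatives of
  \<open>f\<close> and of \<open>g\<close>.\<close>

lemma hess_deriv_eq_ddet:
  "hess_deriv r f g = ddet (r+1) (\<lambda>i j. partial i (partial j f)) (\<lambda>i j. partial i (partial j g))"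
proof -
  define c0 c1 :: "'a poly poly_x \<Rightarrow> 'a poly_x"
    where "c0 = Poly_Mapping.map (\<lambda>p. coeff p 0)" and "c1 = Poly_Mapping.map (\<lambda>p. coeff p 1)"
  have c: "lookup (c0 p) m = coeff (lookup p m) 0" "lookup (c1 p) m = coeff (lookup p m) 1" for p m
    by (simp_all add: c0_def c1_def lookup_map_zero)
  have "hess_deriv r f g = c1 (Determinant.det (Matrix.mat (r+1) (r+1)
      (\<lambda>(i,j). partial i (partial j (pencil f g)))))"
    by (simp add: hess_deriv_def hess_def c1_def)
  also have "\<dots> = ddet (r+1) (\<lambda>i j. c0 (partial i (partial j (pencil f g))))
      (\<lambda>i j. c1 (partial i (partial j (pencil f g))))"
  proof (rule first_order_det)
    show "c0 (x * y) = c0 x * c0 y" for x y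
      by (rule poly_mapping_eqI) (simp add: c lookup_mult_sum coeff_sum coeff_mult)
    show "c1 (x * y) = c1 x * c0 y + c0 x * c1 y" for x y
      by (rule poly_mapping_eqI)
        (simp add: c lookup_mult_sum lookup_add coeff_sum coeff_mult sum.distrib add.commute)
  qed (auto intro!: poly_mapping_eqI simp: c lookup_one lookup_add when_def)
  also have "(\<lambda>i j. c0 (partial i (partial j (pencil f g)))) = (\<lambda>i j. partial i (partial j f))"
    by (intro ext poly_mapping_eqI)
      (simp add: c lookup_partial pencil_def lookup_add lookup_map_zero coeff_mult of_nat_poly algebra_simps)
  also have "(\<lambda>i j. c1 (partial i (partial j (pencil f g)))) = (\<lambda>i j. partial i (partial j g))"
    by (intro ext poly_mapping_eqI)
      (simp add: c lookup_partial pencil_def lookup_add lookup_map_zero coeff_mult of_nat_poly algebra_simps)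
  finally show ?thesis .
qed

section \<open>Rules for the derivative of the determinant\<close>

lemma ddet_add: "ddet n A (\<lambda>i j. B i j + B' i j) = ddet n A B + ddet n A B'"
  by (simp add: ddet_def distrib_right sum.distrib distrib_left)

lemma ddet_scale: "ddet n A (\<lambda>i j. c * B i j) = c * ddet n A B"
  by (simp add: ddet_def sum_distrib_left mult_ac)

text \<open>Euler's relation for the determinant, which is homogeneous of degree \<open>n\<close> in
  the entries.\<close>

lemma ddet_self: "ddet n A A = of_nat n * Determinant.det (Matrix.mat n n (\<lambda>(i,j). A i j))"
proof -
  have "(\<Sum>i = 0..<n. A i (p i) * (\<Prod>j\<in>{0..<n} - {i}. A j (p j))) =
      of_nat n * (\<Prod>i = 0..<n. A i (p i))" for p
  proof -
    have "(\<Sum>i = 0..<n. A i (p i) * (\<Prod>j\<in>{0..<n} - {i}. A j (p j))) =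
        (\<Sum>i = 0..<n. \<Prod>j = 0..<n. A j (p j))"
      by (intro sum.cong refl prod.remove[symmetric]) auto
    then show ?thesis by simp
  qed
  then show ?thesis
    by (simp add: ddet_def det_mat_eq sum_distrib_left mult_ac)
qed

text \<open>Only the identity permutation contributes: any other one moves at least two indices, so
  after deleting one factor an off-diagonal entry, which is 0, remains.\<close>

lemma ddet_diag:
  "ddet n (\<lambda>i j. if i = j then u i else 0) B = (\<Sum>i = 0..<n. B i i * (\<Prod>j\<in>{0..<n} - {i}. u j))"
proof -
  let ?A = "\<lambda>i j. if i = j then u i else 0"
  let ?s = "\<lambda>p. signof p * (\<Sum>i = 0..<n. B i (p i) * (\<Prod>j\<in>{0..<n} - {i}. ?A j (p j)))"
  have "?s p = 0" if p: "p permutes {0..<n}" "p \<noteq> id" for p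
  proof -
    from p(2) obtain k where k: "p k \<noteq> k" by (auto simp: fun_eq_iff)
    have inj: "p x = p y \<longleftrightarrow> x = y" for x y
      using permutes_inj[OF p(1)] by (auto dest: injD)
    \<comment> \<open>If the deleted index is the moved index \<open>k\<close> itself, then
      \<open>p k\<close> is another moved index.\<close>
    have "\<exists>j\<in>{0..<n} - {i}. j \<noteq> p j" for i
    proof (cases "k = i")
      case True
      then have "p k \<in> {0..<n} - {i}" "p k \<noteq> p (p k)"
        using k inj[of k "p k"] p(1) permutes_in_image[OF p(1), of k] permutes_not_in[OF p(1), of k]
        by auto
      then show ?thesis by blast
    next
      case False
      then have "k \<in> {0..<n} - {i}" using k permutes_not_in[OF p(1), of k] by auto
      with k show ?thesis by (intro bexI[of _ k]) auto
    qed
    then have "(\<Prod>j\<in>{0..<n} - {i}. ?A j (p j)) = 0" for i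
      by (intro prod_zero) auto
    then show ?thesis by (simp only: mult_zero_right sum.neutral_const)
  qed
  then have "ddet n ?A B = (\<Sum>p\<in>{id}. ?s p)"
    unfolding ddet_def
    by (intro sum.mono_neutral_right) (auto simp: finite_permutations permutes_id)
  then show ?thesis by simp
qed

lemma det_pCons_0:
  "Determinant.det (Matrix.mat n n (\<lambda>(i,j). [:C i j:])) =
    [:Determinant.det (Matrix.mat n n (\<lambda>(i,j). C i j :: 'a::comm_ring_1)):]"
proof -
  interpret comm_ring_hom "\<lambda>c::'a. [:c:]"
    by unfold_locales (simp_all add: one_pCons)
  show ?thesis
    by (subst hom_det[symmetric], rule arg_cong[of _ _ Determinant.det], rule eq_matI) auto
qed

lemma det_mat_mult:
  fixes A C :: "nat \<Rightarrow> nat \<Rightarrow> 'a::comm_ring_1"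
  shows "Determinant.det (Matrix.mat n n (\<lambda>(i,j). A i j)) * Determinant.det (Matrix.mat n n (\<lambda>(i,j). C i j)) =
    Determinant.det (Matrix.mat n n (\<lambda>(i,j). \<Sum>k = 0..<n. A i k * C k j))"
  by (subst det_mult[symmetric, of _ n])
    (auto intro!: arg_cong[of _ _ Determinant.det] eq_matI simp: scalar_prod_def)

text \<open>This is the coefficient of \<open>t\<close> in
  \<open>det (A + t B) * det C = det (A C + t B C)\<close>.\<close>

lemma ddet_mult:
  "ddet n A B * Determinant.det (Matrix.mat n n (\<lambda>(i,j). C i j)) =
    ddet n (\<lambda>i j. \<Sum>k = 0..<n. A i k * C k j) (\<lambda>i j. \<Sum>k = 0..<n. B i k * C k j)"
proof -
  have sum_pCons: "(\<Sum>k\<in>S. [:a k, b k:]) = [:sum a S, sum b S:]" for S and a b :: "nat \<Rightarrow> 'a"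
    by (induction S rule: infinite_finite_induct) auto
  have "ddet n A B * Determinant.det (Matrix.mat n n (\<lambda>(i,j). C i j)) =
      coeff (Determinant.det (Matrix.mat n n (\<lambda>(i,j). [:A i j, B i j:])) *
        Determinant.det (Matrix.mat n n (\<lambda>(i,j). [:C i j:]))) 1"
    by (simp add: det_pCons_0 coeff_1_det[simplified])
  also have "\<dots> = coeff (Determinant.det (Matrix.mat n n
      (\<lambda>(i,j). [:\<Sum>k = 0..<n. A i k * C k j, \<Sum>k = 0..<n. B i k * C k j:]))) 1"
    unfolding det_mat_mult by (simp add: sum_pCons mult.commute[of "C _ _"])
  finally show ?thesis by (simp only: coeff_1_det)
qed

lemma det_mat_transpose:
  "Determinant.det (Matrix.mat n n (\<lambda>(i,j). A j i)) = Determinant.det (Matrix.mat n n (\<lambda>(i,j). A i j))"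
  by (subst Determinant.det_transpose[symmetric, of _ n])
    (auto intro!: arg_cong[of _ _ Determinant.det] eq_matI)

lemma ddet_transpose: "ddet n (\<lambda>i j. A j i) (\<lambda>i j. B j i) = ddet n A B"
  unfolding coeff_1_det[symmetric] by (subst det_mat_transpose[symmetric]) simp

lemma ddet_cong:
  assumes "\<And>i j. i < n \<Longrightarrow> j < n \<Longrightarrow> A i j = A' i j" "\<And>i j. i < n \<Longrightarrow> j < n \<Longrightarrow> B i j = B' i j"
  shows "ddet n A B = ddet n A' B'"
  unfolding coeff_1_det[symmetric]
  by (intro arg_cong[of _ _ "\<lambda>M. coeff (Determinant.det M) 1"] eq_matI) (auto simp: assms)

text \<open>For the base matrix \<open>a^T diag(u) a\<close> and the direction
  \<open>a^T diag(v) a\<close>, \<open>ddet_mult\<close> splits off \<open>a\<close> on the right;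
  after a transposition it does so again, which leaves the diagonal case.\<close>

lemma ddet_congruence:
  "ddet n (\<lambda>i j. \<Sum>k = 0..<n. a k i * u k * a k j) (\<lambda>i j. \<Sum>k = 0..<n. a k i * v k * a k j) =
    (Determinant.det (Matrix.mat n n (\<lambda>(i,j). a i j)))^2 *
    (\<Sum>i = 0..<n. v i * (\<Prod>j\<in>{0..<n} - {i}. u j))"
proof -
  let ?d = "Determinant.det (Matrix.mat n n (\<lambda>(i,j). a i j))"
  have *: "ddet n (\<lambda>i j. \<Sum>k = 0..<n. a k i * u k * a k j) (\<lambda>i j. \<Sum>k = 0..<n. a k i * v k * a k j) =
      ddet n (\<lambda>i j. u j * a j i) (\<lambda>i j. v j * a j i) * ?d"
    unfolding ddet_mult by (intro ddet_cong) (simp_all add: mult_ac)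
  have "ddet n (\<lambda>i j. u j * a j i) (\<lambda>i j. v j * a j i) =
      ddet n (\<lambda>i j. u i * a i j) (\<lambda>i j. v i * a i j)"
    by (subst ddet_transpose[symmetric]) simp
  also have "\<dots> = ddet n (\<lambda>i j. if i = j then u i else 0) (\<lambda>i j. if i = j then v i else 0) * ?d"
    unfolding ddet_mult by (rule ddet_cong) (simp_all add: if_distrib[of "\<lambda>x. x * _"] cong: if_cong)
  also have "\<dots> = (\<Sum>i = 0..<n. v i * (\<Prod>j\<in>{0..<n} - {i}. u j)) * ?d"
    by (simp add: ddet_diag)
  finally show ?thesis unfolding * by (simp add: power2_eq_square mult_ac)
qed

lemma det_congruence:
  fixes a :: "nat \<Rightarrow> nat \<Rightarrow> 'a::comm_ring_1"
  shows "Determinant.det (Matrix.mat n n (\<lambda>(i,j). \<Sum>k = 0..<n. a k i * u k * a k j)) =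
    (Determinant.det (Matrix.mat n n (\<lambda>(i,j). a i j)))^2 * (\<Prod>i = 0..<n. u i)"
proof -
  have "Determinant.det (Matrix.mat n n (\<lambda>(i,j). \<Sum>k = 0..<n. a k i * u k * a k j)) =
      Determinant.det (Matrix.mat n n (\<lambda>(i,j). u j * a j i)) * Determinant.det (Matrix.mat n n (\<lambda>(i,j). a i j))"
    unfolding det_mat_mult by (simp add: mult_ac)
  also have "Determinant.det (Matrix.mat n n (\<lambda>(i,j). u j * a j i)) =
      Determinant.det (Matrix.mat n n (\<lambda>(i,j). u i * a i j))"
    by (rule det_mat_transpose)
  also have "\<dots> = (\<Prod>i = 0..<n. u i) * Determinant.det (Matrix.mat n n (\<lambda>(i,j). a i j))"
    by (simp add: det_mat_eq prod.distrib sum_distrib_left mult_ac)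
  finally show ?thesis by (simp add: power2_eq_square mult_ac)
qed

section \<open>Evaluation and the derivative of the Hessian\<close>

lemma eval_superset:
  assumes "finite K" "keys p \<subseteq> K"
  shows "eval x p = (\<Sum>m\<in>K. lookup p m * (\<Prod>i\<in>keys m. x i ^ lookup m i))"
  unfolding eval_def using assms by (intro sum.mono_neutral_left) (auto simp: in_keys_iff)

lemma eval_single: "eval x (single m c) = c * (\<Prod>i\<in>keys m. x i ^ lookup m i)"
  by (subst eval_superset[of "{m}"]) auto

lemma eval_0 [simp]: "eval x 0 = 0"
  by (simp add: eval_def)

lemma eval_add: "eval x (p + q) = eval x p + eval x q"
proof -
  have "keys (p + q) \<subseteq> keys p \<union> keys q" by (rule keys_add)
  then show ?thesis
    using eval_superset[of "keys p \<union> keys q" p x] eval_superset[of "keys p \<union> keys q" q x]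
      eval_superset[of "keys p \<union> keys q" "p + q" x]
    by (simp add: lookup_add sum.distrib distrib_right)
qed

lemma eval_mult: "eval x (p * q) = eval x p * eval x q"
proof (induction p rule: poly_mapping_single_induct)
  case (single m c)
  show ?case
  proof (induction q rule: poly_mapping_single_induct)
    case (single n e)
    have ext: "(\<Prod>i\<in>keys k. x i ^ lookup k i) = (\<Prod>i\<in>keys m \<union> keys n. x i ^ lookup k i)"
      if "keys k \<subseteq> keys m \<union> keys n" for k
      using that by (intro prod.mono_neutral_left) (auto simp: in_keys_iff)
    have "(\<Prod>i\<in>keys (m + n). x i ^ lookup (m + n) i) =
        (\<Prod>i\<in>keys m. x i ^ lookup m i) * (\<Prod>i\<in>keys n. x i ^ lookup n i)"
      unfolding ext[OF keys_add] ext[OF Un_upper1] ext[OF Un_upper2]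
      by (simp add: lookup_add power_add prod.distrib)
    then show ?case
      by (simp add: mult_single eval_single mult_ac)
  qed (simp add: algebra_simps eval_add)
qed (simp add: algebra_simps eval_add)

lemma eval_Const [simp]: "eval x (Const c) = c"
  by (simp add: Const_def eval_single)

lemma eval_Var [simp]: "eval x (Var i) = x i"
  by (simp add: Var_def eval_single)

lemma eval_1 [simp]: "eval x 1 = 1"
  using eval_Const[of x 1] by (simp add: Const_1)

lemma eval_sum: "eval x (\<Sum>a\<in>A. h a) = (\<Sum>a\<in>A. eval x (h a))"
  by (induction A rule: infinite_finite_induct) (simp_all add: eval_add)

lemma eval_prod: "eval x (\<Prod>a\<in>A. h a) = (\<Prod>a\<in>A. eval x (h a))"
  by (induction A rule: infinite_finite_induct) (simp_all add: eval_mult)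

lemma eval_power: "eval x (p ^ n) = eval x p ^ n"
  by (induction n) (simp_all add: eval_mult)

section \<open>The differential of the Hessian map on representatives\<close>

lemma hess_deriv_add: "hess_deriv r f (g + g') = hess_deriv r f g + hess_deriv r f g'"
  by (simp add: hess_deriv_eq_ddet partial_add ddet_add)

lemma hess_deriv_Const_mult: "hess_deriv r f (Const c * g) = Const c * hess_deriv r f g"
  by (simp add: hess_deriv_eq_ddet partial_Const_mult ddet_scale)

lemma hess_deriv_self: "hess_deriv r f f = of_nat (r + 1) * hess r f"
  by (simp only: hess_deriv_eq_ddet ddet_self hess_def)

lemma hess_deriv_0: "hess_deriv r f 0 = 0"
  using hess_deriv_Const_mult[of r f 0 0] by (simp add: Const_0)

text \<open>The derivative in direction \<open>q\<close> is \<open>(r + 1) * hess r q\<close>. So a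
  direction whose derivative is a multiple of \<open>hess r q\<close> acquires derivative 0 after
  subtraction of a multiple of \<open>q\<close>. Conversely, the right-hand side for
  \<open>g = q\<close> yields \<open>hess r q \<noteq> 0\<close>.\<close>

lemma immersion_iff:
  fixes q :: "'k::field_char_0 poly_x"
  assumes q: "q \<in> forms d r" "q \<noteq> 0"
  shows "proj_class q \<in> hessian_domain d r \<and>
      inj_on (hessian_differential r) (tangent_space d r (proj_class q)) \<longleftrightarrow>
    (\<forall>g\<in>forms d r. hess_deriv r q g = 0 \<longrightarrow> g = 0)" (is "?L \<longleftrightarrow> ?R")
proof -
  have self: "q \<in> proj_class q"
    unfolding proj_class_def by (intro CollectI exI[of _ 1]) (simp add: Const_1)
  show ?thesis
  proof
    assume L: ?L
    then have hess: "hess r q \<noteq> 0" using self by (auto simp: hessian_domain_def)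
    show ?R
    proof (intro ballI impI)
      fix g assume g: "g \<in> forms d r" "hess_deriv r q g = 0"
      have "tangent_vector q g = tangent_vector q 0"
      proof (rule inj_onD[OF conjunct2[OF L]])
        show "hessian_differential r (tangent_vector q g) = hessian_differential r (tangent_vector q 0)"
          by (simp add: hessian_differential_tangent_vector g hess_deriv_0)
        show "tangent_vector q g \<in> tangent_space d r (proj_class q)"
          "tangent_vector q 0 \<in> tangent_space d r (proj_class q)"
          unfolding tangent_space_def using self g zero_in_forms[of d r] by blast+
      qed
      then have "tangent_vector q 0 = tangent_vector q g" by (rule sym)
      then obtain c where c: "g = 0 + Const c * q"
        unfolding tangent_vector_eq_iff[OF q(2)] by blast
      with g have "Const c * (of_nat (r + 1) * hess r q) = 0"
        by (simp only: add_0 hess_deriv_Const_mult hess_deriv_self)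
      with hess have "c = 0"
        by (simp only: mult_eq_0_iff Const_eq_0_iff of_nat_eq_0_iff) simp
      with c show "g = 0" by (simp add: Const_0)
    qed
  next
    assume R: ?R
    then have hess: "hess r q \<noteq> 0"
      using q by (auto simp: hess_deriv_self)
    have "proj_class q \<in> hessian_domain d r"
      unfolding hessian_domain_def Sigma_space_def
      using q hess by (auto simp: proj_class_def hess_Const_mult simp del: power_Suc)
    moreover have "inj_on (hessian_differential r) (tangent_space d r (proj_class q))"
    proof (rule inj_onI)
      \<comment> \<open>A representative over \<open>Const c * q\<close> is rescaled by
        \<open>1 / c\<close>, so that all tangent vectors are compared over the same
        \<open>q\<close>.\<close>
      have normal: "\<exists>g\<in>forms d r. v = tangent_vector q g" if "v \<in> tangent_space d r (proj_class q)" for v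
      proof -
        from that obtain c g where v: "v = tangent_vector (Const c * q) g" "c \<noteq> 0" "g \<in> forms d r"
          by (auto simp: tangent_space_def proj_class_def)
        have "Const c * (Const (1 / c) * g) = g"
          using v(2) by (simp add: mult.assoc[symmetric] Const_mult[symmetric] Const_1)
        then have "v = tangent_vector q (Const (1 / c) * g)"
          by (metis tangent_vector_Const[OF v(2), of q "Const (1 / c) * g" 0] v(1) Const_0
              mult_zero_left add.right_neutral)
        with v(3) show ?thesis by (blast intro: forms_Const_mult)
      qed
      fix v w assume "v \<in> tangent_space d r (proj_class q)" "w \<in> tangent_space d r (proj_class q)"
        and eq: "hessian_differential r v = hessian_differential r w"
      then obtain g h where v: "v = tangent_vector q g" "g \<in> forms d r"
        and w: "w = tangent_vector q h" "h \<in> forms d r" using normal by metis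
      from eq obtain c where c: "hess_deriv r q h = hess_deriv r q g + Const c * hess r q"
        unfolding v w hessian_differential_tangent_vector tangent_vector_eq_iff[OF hess] ..
      \<comment> \<open>Chosen so that the derivative in direction \<open>Const b * q\<close> is
        exactly \<open>Const c * hess r q\<close>.\<close>
      define b where "b = c / of_nat (r + 1)"
      let ?k = "h + Const (-1) * (g + Const b * q)"
      have b: "Const b * of_nat (r + 1) = (Const c :: 'k poly_x)"
        unfolding Const_of_nat[symmetric] Const_mult[symmetric] b_def by (simp del: of_nat_Suc)
      have "hess_deriv r q ?k = hess_deriv r q h - (hess_deriv r q g + (Const b * of_nat (r + 1)) * hess r q)"
        unfolding hess_deriv_add[of r q h] hess_deriv_Const_mult[of r q "-1"] hess_deriv_add[of r q g]
          hess_deriv_Const_mult[of r q b] hess_deriv_self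
        unfolding Const_uminus Const_1
        by (simp only: mult_minus_left mult_1_left mult.assoc diff_conv_add_uminus)
      then have "hess_deriv r q ?k = 0" unfolding b c by simp
      moreover have "?k \<in> forms d r"
        using v w q by (intro forms_add forms_Const_mult)
      ultimately have "?k = 0" using R by blast
      then have "h = g + Const b * q" by (simp add: Const_uminus Const_1 algebra_simps)
      then show "v = w" unfolding v w tangent_vector_eq_iff[OF q(2)] by blast
    qed
    ultimately show ?L ..
  qed
qed

section \<open>Degeneracy at sums of \<open>r + 1\<close> powers\<close>

lemma forms_0_eq_Const: "p \<in> forms 0 r \<Longrightarrow> p = Const (lookup p 0)"
proof (rule poly_mapping_eqI)
  fix m :: "nat \<Rightarrow>\<^sub>0 nat" assume "p \<in> forms 0 r"
  moreover have "m = 0" if "mon_degree m = 0"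
    using that by (intro poly_mapping_eqI) (auto simp: mon_degree_def in_keys_iff)
  ultimately show "lookup p m = lookup (Const (lookup p 0)) m"
    by (auto simp: forms_iff Const_def lookup_single when_def)
qed

lemma partial_partial_linear: "l \<in> forms 1 r \<Longrightarrow> partial i (partial j l) = 0"
  using forms_0_eq_Const[OF partial_in_forms[of l 0 r j]] partial_Const by (metis One_nat_def)

text \<open>The factors are ordered as in \<open>ddet_congruence\<close>: the Hessian matrix of a
  sum of powers is \<open>a^T diag(u) a\<close>, where \<open>a\<close> holds the coefficients of
  the linear forms.\<close>

lemma partial_partial_power:
  assumes "l \<in> forms 1 r"
  shows "partial i (partial j (l ^ (e + 2))) =
    partial i l * (of_nat ((e + 2) * (e + 1)) * l ^ e) * partial j l"
proof -
  have n: "partial i (of_nat n) = 0" for n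
    using partial_Const[of i "of_nat n"] by (simp add: Const_of_nat)
  have "partial j (l ^ Suc (Suc e)) = of_nat (Suc (Suc e)) * l ^ Suc e * partial j l"
    by (rule partial_power)
  moreover have "partial i (of_nat (Suc (Suc e)) * l ^ Suc e * partial j l) =
      of_nat (Suc (Suc e)) * (of_nat (Suc e) * l ^ e * partial i l) * partial j l"
    by (simp only: partial_mult partial_partial_linear[OF assms] n partial_power) simp
  ultimately show ?thesis by (simp only: add_2_eq_Suc' of_nat_mult mult_ac Suc_eq_plus1)
qed

text \<open>In the direction \<open>l 0 ^ d - l 1 ^ d\<close>, with \<open>d = e + 2\<close>, the
  contributions of the first two diagonal entries cancel. Should this direction be 0, then
  \<open>hess r q = 0\<close> and \<open>q\<close> itself is in the kernel.\<close>

lemma not_immersive_sum_of_powers: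
  fixes q :: "'k::field_char_0 poly_x"
  assumes "r \<ge> 1" "\<And>k. k < r + 1 \<Longrightarrow> l k \<in> forms 1 r" "q = (\<Sum>k<r + 1. l k ^ (e + 2))" "q \<noteq> 0"
  shows "\<exists>g\<in>forms (e + 2) r. hess_deriv r q g = 0 \<and> g \<noteq> 0"
proof (rule ccontr)
  assume "\<not> ?thesis"
  then have R: "g = 0" if "g \<in> forms (e + 2) r" "hess_deriv r q g = 0" for g
    using that by blast
  define g where "g = l 0 ^ (e + 2) - l 1 ^ (e + 2)"
  \<comment> \<open>In the same congruence, the direction \<open>g\<close> has the diagonal entries
    \<open>s k * u k\<close>.\<close>
  define s :: "nat \<Rightarrow> 'k poly_x" where "s k = (if k = 0 then 1 else if k = 1 then -1 else 0)" for k
  define u where "u k = of_nat ((e + 2) * (e + 1)) * l k ^ e" for k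
  let ?d = "Determinant.det (Matrix.mat (r+1) (r+1) (\<lambda>(k,i). partial i (l k)))"
  have pow: "l k ^ (e + 2) \<in> forms (e + 2) r" if "k < r + 1" for k
    using forms_power[OF assms(2)[OF that], of "e + 2"] by simp
  have q: "q \<in> forms (e + 2) r" unfolding assms(3) by (intro forms_sum pow) simp
  have g: "g \<in> forms (e + 2) r" unfolding g_def using assms(1) by (intro forms_diff pow) auto
  have q2: "partial i (partial j q) = (\<Sum>k = 0..<r + 1. partial i (l k) * u k * partial j (l k))" for i j
    unfolding assms(3) partial_sum u_def lessThan_atLeast0
    by (intro sum.cong refl partial_partial_power[where r = r] assms(2)) simp
  have sum_s: "(\<Sum>k = 0..<r + 1. s k * h k) = h 0 - h 1" for h :: "nat \<Rightarrow> 'k poly_x"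
  proof -
    have "(\<Sum>k = 0..<r + 1. s k * h k) = (\<Sum>k\<in>{0, 1}. s k * h k)"
      using assms(1) by (intro sum.mono_neutral_right) (auto simp: s_def)
    then show ?thesis by (simp add: s_def)
  qed
  have g2: "partial i (partial j g) = (\<Sum>k = 0..<r + 1. partial i (l k) * (s k * u k) * partial j (l k))" for i j
  proof -
    have "partial i (partial j g) = partial i (l 0) * u 0 * partial j (l 0) - partial i (l 1) * u 1 * partial j (l 1)"
      unfolding g_def partial_diff u_def using assms(1)
      by (simp only: partial_partial_power[OF assms(2)] zero_less_Suc Suc_eq_plus1[symmetric] One_nat_def Suc_less_eq less_eq_Suc_le)
    also have "\<dots> = (\<Sum>k = 0..<r + 1. s k * (partial i (l k) * u k * partial j (l k)))"
      by (simp only: sum_s)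
    finally show ?thesis by (simp add: mult_ac)
  qed
  have "hess_deriv r q g = ?d\<^sup>2 * (\<Sum>i = 0..<r + 1. (s i * u i) * (\<Prod>j\<in>{0..<r + 1} - {i}. u j))"
    unfolding hess_deriv_eq_ddet q2 g2 by (rule ddet_congruence)
  also have "(\<Sum>i = 0..<r + 1. (s i * u i) * (\<Prod>j\<in>{0..<r + 1} - {i}. u j)) =
      (\<Sum>i = 0..<r + 1. s i * (\<Prod>j = 0..<r + 1. u j))"
  proof (rule sum.cong[OF refl])
    fix i assume i: "i \<in> {0..<r + 1}"
    have "(\<Prod>j = 0..<r + 1. u j) = u i * (\<Prod>j\<in>{0..<r + 1} - {i}. u j)"
      by (rule prod.remove[OF _ i]) simp
    then show "(s i * u i) * (\<Prod>j\<in>{0..<r + 1} - {i}. u j) = s i * (\<Prod>j = 0..<r + 1. u j)"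
      by (simp only: mult.assoc)
  qed
  also have "\<dots> = 0" by (simp only: sum_s) simp
  finally have "g = 0" using R g by simp
  \<comment> \<open>Adding the Hessian matrix of \<open>g = 0\<close> changes nothing, but it turns
    the diagonal into \<open>(1 + s k) * u k\<close>, whose entry at \<open>k = 1\<close> is
    0.\<close>
  have "partial i (partial j q) =
      (\<Sum>k = 0..<r + 1. partial i (l k) * ((1 + s k) * u k) * partial j (l k))" for i j
    using q2[of i j] g2[of i j] \<open>g = 0\<close> by (simp add: algebra_simps sum.distrib)
  then have "hess r q = ?d\<^sup>2 * (\<Prod>i = 0..<r + 1. (1 + s i) * u i)"
    unfolding hess_def by (simp only: det_congruence)
  also have "(\<Prod>i = 0..<r + 1. (1 + s i) * u i) = 0"
    using assms(1) by (intro prod_zero bexI[of _ 1]) (auto simp: s_def)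
  finally have "hess_deriv r q q = 0" by (simp add: hess_deriv_self)
  with R q assms(4) show False by blast
qed

section \<open>Injectivity at the sum of powers\<close>

lemma prod_remove2:
  fixes y :: "nat \<Rightarrow> 'a::comm_ring_1"
  assumes "finite S" "k \<in> S" "j \<in> S" "j \<noteq> k"
  shows "prod y (S - {j}) = y k * prod y (S - {j, k})"
proof -
  have "S - {j} - {k} = S - {j, k}" by auto
  with prod.remove[of "S - {j}" k y] assms show ?thesis by simp
qed

text \<open>Multiplying by \<open>C\<close> turns the base matrix into \<open>D\<close> times the
  identity, where the derivative in direction \<open>B C\<close> is \<open>D ^ (n - 1)\<close> times
  the trace of \<open>B C\<close>. Since \<open>D \<noteq> 0\<close>, the trace vanishes, and it
  expands to the stated sum.\<close>

lemma ddet_diag_plus_const: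
  fixes y :: "nat \<Rightarrow> 'a::idom" and B :: "nat \<Rightarrow> nat \<Rightarrow> 'a" and n :: nat
  defines "S \<equiv> {0..<n}"
  assumes c: "c \<noteq> 0" and nz: "prod y S + z * (\<Sum>i\<in>S. prod y (S - {i})) \<noteq> 0"
    and zero: "ddet n (\<lambda>i j. c * ((if i = j then y i else 0) + z)) B = 0"
  shows "(\<Sum>i\<in>S. prod y (S - {i}) * B i i) +
    z * (\<Sum>i\<in>S. \<Sum>j\<in>S - {i}. prod y (S - {i, j}) * (B i i - B i j)) = 0"
proof -
  define P where "P k = prod y (S - {k})" for k
  define P2 where "P2 j k = prod y (S - {j, k})" for j k
  \<comment> \<open>\<open>C\<close> is the adjugate of the matrix up to powers of \<open>c\<close>; only the product computed in \<open>AC\<close> is needed.\<close>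
  define C where "C i k = (if i = k then P k + z * (\<Sum>j\<in>S - {k}. P2 j k) else - z * P2 i k)" for i k
  define D where "D = c * (prod y S + z * (\<Sum>i\<in>S. P i))"
  have S [simp]: "finite S" by (simp add: S_def)
  have P2_commute: "P2 j k = P2 k j" for j k by (simp add: P2_def insert_commute)
  have P2: "P j = y k * P2 j k" if "j \<in> S" "k \<in> S" "j \<noteq> k" for j k
    unfolding P_def P2_def using that by (intro prod_remove2) auto
  have colsum: "(\<Sum>j\<in>S. C j k) = P k" if k: "k \<in> S" for k
  proof -
    have "(\<Sum>j\<in>S. C j k) = C k k + (\<Sum>j\<in>S - {k}. C j k)"
      using k by (intro sum.remove) auto
    also have "(\<Sum>j\<in>S - {k}. C j k) = (\<Sum>j\<in>S - {k}. - z * P2 j k)"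
      by (intro sum.cong) (auto simp: C_def)
    finally show ?thesis by (simp add: C_def sum_negf sum_distrib_left)
  qed
  have AC: "(\<Sum>j\<in>S. c * ((if i = j then y i else 0) + z) * C j k) = (if i = k then D else 0)"
    if i: "i \<in> S" and k: "k \<in> S" for i k
  proof -
    have "(\<Sum>j\<in>S. c * ((if i = j then y i else 0) + z) * C j k) =
        c * ((\<Sum>j\<in>S. (if i = j then y i else 0) * C j k) + z * (\<Sum>j\<in>S. C j k))"
      by (simp add: sum_distrib_left sum.distrib[symmetric] algebra_simps)
    also have "(\<Sum>j\<in>S. (if i = j then y i else 0) * C j k) = y i * C i k"
      using i by (simp add: if_distrib[of "\<lambda>x. x * _"] cong: if_cong)
    also have "(\<Sum>j\<in>S. C j k) = P k" by (rule colsum[OF k])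
    also have "c * (y i * C i k + z * P k) = (if i = k then D else 0)"
    proof (cases "i = k")
      case True
      have "y k * (\<Sum>j\<in>S - {k}. P2 j k) = (\<Sum>j\<in>S - {k}. P j)"
        unfolding sum_distrib_left by (intro sum.cong refl P2[symmetric]) (use k in auto)
      moreover have "(\<Sum>j\<in>S. P j) = P k + (\<Sum>j\<in>S - {k}. P j)"
        using k by (intro sum.remove) auto
      moreover have "prod y S = y k * P k" unfolding P_def using k by (intro prod.remove) auto
      ultimately show ?thesis using True by (simp add: C_def D_def algebra_simps)
    next
      case False
      then show ?thesis using P2[OF k i] P2_commute[of i k] by (simp add: C_def algebra_simps)
    qed
    finally show ?thesis .
  qed
  have "ddet n (\<lambda>i j. if i = j then D else 0) (\<lambda>i j. \<Sum>k\<in>S. B i k * C k j) =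
      ddet n (\<lambda>i j. \<Sum>k\<in>S. c * ((if i = k then y i else 0) + z) * C k j) (\<lambda>i j. \<Sum>k\<in>S. B i k * C k j)"
    by (intro ddet_cong AC[symmetric]) (auto simp: S_def)
  also have "\<dots> = 0"
    unfolding S_def ddet_mult[symmetric] zero by simp
  finally have "(\<Sum>i\<in>S. (\<Sum>k\<in>S. B i k * C k i) * (\<Prod>j\<in>S - {i}. D)) = 0"
    by (simp add: ddet_diag S_def)
  moreover have "(\<Prod>j\<in>S - {i}. D) = D ^ (n - 1)" if "i \<in> S" for i
    using that by (simp add: S_def card_Diff_subset)
  ultimately have "D ^ (n - 1) * (\<Sum>i\<in>S. \<Sum>k\<in>S. B i k * C k i) = 0"
    by (simp add: sum_distrib_left mult.commute)
  moreover have "D \<noteq> 0" unfolding D_def P_def using c nz by simp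
  ultimately have "(\<Sum>i\<in>S. \<Sum>k\<in>S. B i k * C k i) = 0" by simp
  moreover have "(\<Sum>k\<in>S. B i k * C k i) = P i * B i i + z * (\<Sum>j\<in>S - {i}. P2 i j * (B i i - B i j))"
    if i: "i \<in> S" for i
  proof -
    have "(\<Sum>k\<in>S. B i k * C k i) = B i i * C i i + (\<Sum>k\<in>S - {i}. B i k * C k i)"
      using i by (intro sum.remove) auto
    also have "(\<Sum>k\<in>S - {i}. B i k * C k i) = (\<Sum>k\<in>S - {i}. - (z * P2 i k * B i k))"
      by (intro sum.cong) (auto simp: C_def P2_commute[of _ i] algebra_simps)
    finally show ?thesis
      by (simp add: C_def P2_commute[of _ i] algebra_simps sum_distrib_left sum_subtractf sum_negf
          sum.distrib)
  qed
  ultimately show ?thesis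
    by (simp add: sum.distrib sum_distrib_left P_def P2_def)
qed

section \<open>Congruences modulo monomial ideals\<close>

text \<open>Such sets are the complements of the monomial sets of monomial ideals. For down-closed
  \<open>N\<close>, \<open>vanishes_on N p\<close> expresses that \<open>p\<close> lies in the
  ideal, without quotient rings.\<close>

definition down_closed :: "('v \<Rightarrow>\<^sub>0 nat) set \<Rightarrow> bool" where
  "down_closed N \<longleftrightarrow> (\<forall>a b. a + b \<in> N \<longrightarrow> a \<in> N)"

definition vanishes_on :: "('v \<Rightarrow>\<^sub>0 nat) set \<Rightarrow> ('v, 'a::comm_ring_1) mpoly \<Rightarrow> bool" where
  "vanishes_on N p \<longleftrightarrow> (\<forall>m\<in>N. lookup p m = 0)"

lemma vanishes_on_0 [simp]: "vanishes_on N 0"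
  by (simp add: vanishes_on_def)

lemma vanishes_on_add: "vanishes_on N p \<Longrightarrow> vanishes_on N q \<Longrightarrow> vanishes_on N (p + q)"
  by (simp add: vanishes_on_def lookup_add)

lemma vanishes_on_uminus: "vanishes_on N (- p) \<longleftrightarrow> vanishes_on N p"
  by (simp add: vanishes_on_def)

lemma vanishes_on_sum: "(\<And>x. x \<in> A \<Longrightarrow> vanishes_on N (h x)) \<Longrightarrow> vanishes_on N (\<Sum>x\<in>A. h x)"
  by (induction A rule: infinite_finite_induct) (auto intro: vanishes_on_add)

text \<open>If a product of two monomials lies in \<open>N\<close>, so does the first one, and its
  coefficient in \<open>p\<close> is 0.\<close>

lemma vanishes_on_mult:
  assumes "down_closed N" "vanishes_on N p"
  shows "vanishes_on N (p * q)"
  using assms unfolding vanishes_on_def down_closed_def lookup_mult_sum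
  by (auto intro!: sum.neutral)

lemma Var_power: "Var i ^ n = single (single i n) 1"
proof (induction n)
  case (Suc n)
  have "single i 1 + single i n = single i (Suc n)"
    by (simp add: single_add[symmetric])
  then show ?case unfolding power_Suc Suc unfolding Var_def mult_single by simp
qed simp

lemma vanishes_on_Var_power:
  assumes "\<And>m. m \<in> N \<Longrightarrow> lookup m i < e"
  shows "vanishes_on N (Var i ^ e)"
  using assms by (fastforce simp: vanishes_on_def Var_power lookup_single when_def)

text \<open>When \<open>N\<close> is closed under multiplication by \<open>x_k\<close>, the variable
  \<open>x_k\<close> is a nonzerodivisor modulo the ideal: the coefficient of \<open>x_k p\<close>
  at \<open>m + single k 1\<close> is that of \<open>p\<close> at \<open>m\<close>.\<close>

lemma vanishes_on_cancel_Var: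
  assumes "\<And>m. m \<in> N \<Longrightarrow> m + single k 1 \<in> N" "vanishes_on N (Var k * p)"
  shows "vanishes_on N p"
  unfolding vanishes_on_def
proof
  fix m assume "m \<in> N"
  then have "lookup (Var k * p) (single k 1 + m) = 0"
    using assms by (simp add: vanishes_on_def add.commute)
  then show "lookup p m = 0"
    by (simp add: Var_def lookup_single_mult)
qed

lemma vanishes_on_cancel_Var_power:
  assumes "\<And>m. m \<in> N \<Longrightarrow> m + single k 1 \<in> N" "vanishes_on N (Var k ^ n * p)"
  shows "vanishes_on N p"
  using assms(2) by (induction n) (auto simp: mult.assoc intro: vanishes_on_cancel_Var[OF assms(1)])

lemma vanishes_on_cancel_prod:
  assumes "\<And>m k. m \<in> N \<Longrightarrow> k \<in> A \<Longrightarrow> m + single k 1 \<in> N" "finite A"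
    and "vanishes_on N ((\<Prod>k\<in>A. Var k ^ n) * p)"
  shows "vanishes_on N p"
  using assms(2,1,3)
  by (induction A) (auto simp: mult.assoc dest: vanishes_on_cancel_Var_power[rotated])

text \<open>If \<open>p\<close> has a monomial in \<open>N\<close>, choose one of maximal degree in \<open>x\<^sub>k\<close>: multiplied
  by \<open>x\<^sub>k\<close>, it cannot cancel in the product.\<close>

lemma vanishes_on_cancel_sum:
  fixes p :: "(nat, 'a::comm_ring_1) mpoly"
  assumes down: "down_closed N" and up: "\<And>m. m \<in> N \<Longrightarrow> m + single k 1 \<in> N"
    and k: "k \<in> A" "finite A"
    and vanish: "vanishes_on N ((\<Sum>i\<in>A. Var i) * p)"
  shows "vanishes_on N p"
proof (rule ccontr)
  assume "\<not> ?thesis"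
  then have ne: "N \<inter> keys p \<noteq> {}" by (auto simp: vanishes_on_def in_keys_iff)
  define M where "M = Max ((\<lambda>m. lookup m k) ` (N \<inter> keys p))"
  have "M \<in> (\<lambda>m. lookup m k) ` (N \<inter> keys p)"
    unfolding M_def using ne by (intro Max_in) auto
  then obtain m where m: "m \<in> N" "m \<in> keys p" "lookup m k = M" by auto
  have max: "lookup p m' = 0" if "m' \<in> N" "lookup m' k > M" for m'
  proof (rule ccontr)
    assume "lookup p m' \<noteq> 0"
    with that have "lookup m' k \<le> M" unfolding M_def by (intro Max_ge) (auto simp: in_keys_iff)
    with that show False by simp
  qed
  have "lookup (Var i * p) (m + single k 1) = 0" if i: "i \<noteq> k" for i
  proof (cases "\<exists>b. m + single k 1 = single i 1 + b")
    case True
    then obtain b where b: "m + single k 1 = single i 1 + b" ..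
    have "b + single i 1 \<in> N" using up[OF m(1)] unfolding b by (simp only: add.commute)
    then have "b \<in> N" using down by (auto simp: down_closed_def)
    moreover have "lookup b k = M + 1"
      using arg_cong[OF b, of "\<lambda>m. lookup m k"] i m(3) by (simp add: lookup_add lookup_single when_def)
    ultimately show ?thesis unfolding b Var_def by (simp add: lookup_single_mult max)
  next
    case False
    then show ?thesis by (simp add: Var_def lookup_single_mult_0)
  qed
  then have "lookup ((\<Sum>i\<in>A. Var i) * p) (m + single k 1) = lookup (Var k * p) (single k 1 + m)"
    unfolding sum_distrib_right lookup_sum unfolding sum.remove[OF k(2,1)] by (simp add: add.commute)
  also have "\<dots> = lookup p m" by (simp add: Var_def lookup_single_mult)
  finally show False
    using vanish up[OF m(1)] m(2) by (simp add: vanishes_on_def in_keys_iff)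
qed

lemma vanishes_on_cancel_sum_power:
  fixes p :: "(nat, 'a::comm_ring_1) mpoly"
  assumes "down_closed N" "\<And>m. m \<in> N \<Longrightarrow> m + single k 1 \<in> N" "k \<in> A" "finite A"
    and "vanishes_on N ((\<Sum>i\<in>A. Var i) ^ n * p)"
  shows "vanishes_on N p"
  using assms(5) by (induction n) (auto simp: mult.assoc intro: vanishes_on_cancel_sum[OF assms(1-4)])

lemma eq_single_of_mon_degree:
  assumes "mon_degree m \<le> lookup m i"
  shows "m = single i (mon_degree m)"
proof -
  have "m = single i (lookup m i) + (m - single i (lookup m i))"
    by (intro poly_mapping_eqI) (auto simp: lookup_add lookup_minus lookup_single when_def)
  then have "mon_degree m = lookup m i + mon_degree (m - single i (lookup m i))"
    by (metis mon_degree_add mon_degree_single)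
  with assms have 0: "mon_degree (m - single i (lookup m i)) = 0" "mon_degree m = lookup m i" by auto
  have "m - single i (lookup m i) = 0"
    using 0(1) by (intro poly_mapping_eqI) (auto simp: mon_degree_def in_keys_iff)
  with 0(2) show ?thesis
    using \<open>m = single i (lookup m i) + (m - single i (lookup m i))\<close> by simp
qed

text \<open>In degree \<open>e\<close>, the ideal generated by the \<open>x_i ^ e\<close> with
  \<open>i \<in> I\<close> contains only their linear combinations: a monomial of degree
  \<open>e\<close> with an exponent at least \<open>e\<close> is a pure power.\<close>

lemma form_eq_sum_Var_power:
  assumes p: "p \<in> forms e r" and e: "e \<ge> 1" and I: "finite I"
    and vanish: "vanishes_on {m. \<forall>i\<in>I. lookup m i < e} p"
  shows "p = (\<Sum>i\<in>I. Const (lookup p (single i e)) * Var i ^ e)"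
proof (rule poly_mapping_eqI)
  fix m
  have eq: "lookup (\<Sum>i\<in>I. Const (lookup p (single i e)) * Var i ^ e) m =
      (\<Sum>i\<in>I. if single i e = m then lookup p m else 0)"
    by (auto simp: lookup_sum lookup_Const_mult Var_power lookup_single when_def intro!: sum.cong)
  show "lookup p m = lookup (\<Sum>i\<in>I. Const (lookup p (single i e)) * Var i ^ e) m"
  proof (cases "lookup p m = 0")
    case True
    then show ?thesis unfolding eq by (simp cong: if_cong)
  next
    case False
    then have "\<not> (\<forall>i\<in>I. lookup m i < e)" "mon_degree m = e"
      using vanish p by (auto simp: vanishes_on_def forms_iff)
    then obtain i where i: "i \<in> I" "m = single i e"
      using eq_single_of_mon_degree[of m] by (metis not_less)
    have "single j e = m \<longleftrightarrow> j = i" for j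
      using i(2) e by (auto dest: arg_cong[of _ _ "\<lambda>m. lookup m i"] simp: lookup_single when_def split: if_splits)
    then show ?thesis unfolding eq using i(1) I by simp
  qed
qed

text \<open>The coefficients with respect to the divided monomials \<open>x\<^sup>m / m!\<close>, on which partial
  derivatives act as shifts.\<close>

definition divided_coeff :: "('v, 'a::comm_ring_1) mpoly \<Rightarrow> ('v \<Rightarrow>\<^sub>0 nat) \<Rightarrow> 'a" where
  "divided_coeff p m = of_nat (\<Prod>i\<in>keys m. fact (lookup m i)) * lookup p m"

lemma divided_coeff_partial:
  fixes p :: "('v, 'a::comm_ring_1) mpoly"
  shows "divided_coeff (partial i p) m = divided_coeff p (m + single i 1)"
proof -
  let ?K = "insert i (keys m)"
  have fact: "(\<Prod>j\<in>keys n. fact (lookup n j)) = (\<Prod>j\<in>?K. fact (lookup n j) :: nat)"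
    if "keys n \<subseteq> ?K" for n :: "'v \<Rightarrow>\<^sub>0 nat"
    using that by (intro prod.mono_neutral_left) (auto simp: in_keys_iff)
  have "(\<Prod>j\<in>?K. fact (lookup (m + single i 1) j) :: nat) = (lookup m i + 1) * (\<Prod>j\<in>?K. fact (lookup m j))"
  proof -
    have "(\<Prod>j\<in>?K. fact (lookup (m + single i 1) j) :: nat) =
        (\<Prod>j\<in>?K. (if j = i then lookup m i + 1 else 1) * fact (lookup m j))"
      by (intro prod.cong) (auto simp: lookup_add lookup_single)
    then show ?thesis by (simp add: prod.distrib)
  qed
  moreover have "keys (m + single i 1) \<subseteq> ?K" using keys_add[of m "single i 1"] by auto
  ultimately have "(\<Prod>j\<in>keys (m + single i 1). fact (lookup (m + single i 1) j)) =
      (lookup m i + 1) * (\<Prod>j\<in>keys m. fact (lookup m j) :: nat)"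
    using fact[of m] fact[of "m + single i 1"] by (simp only: subset_insertI)
  then show ?thesis
    unfolding divided_coeff_def lookup_partial by (simp only: of_nat_mult mult_ac)
qed

lemma divided_coeff_add: "divided_coeff (p + q) m = divided_coeff p m + divided_coeff q m"
  by (simp add: divided_coeff_def lookup_add distrib_left)

lemma divided_coeff_diff: "divided_coeff (p - q) m = divided_coeff p m - divided_coeff q m"
  by (simp add: divided_coeff_def lookup_minus right_diff_distrib)

lemma divided_coeff_Const_mult: "divided_coeff (Const c * p) m = c * divided_coeff p m"
  by (simp add: divided_coeff_def lookup_Const_mult)

lemma divided_coeff_Var_power:
  "divided_coeff (Var i ^ n) m = (if m = single i n then fact n else 0)"
  by (auto simp: divided_coeff_def Var_power lookup_single when_def keys_single)

lemma obtain_add_single: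
  assumes "i \<in> keys (m :: 'v \<Rightarrow>\<^sub>0 nat)"
  obtains n where "m = n + single i 1"
proof
  show "m = (m - single i 1) + single i 1"
    using assms by (intro poly_mapping_eqI)
      (auto simp: lookup_add lookup_minus lookup_single when_def in_keys_iff)
qed

text \<open>The multinomial coefficient \<open>n! / m!\<close> times \<open>m!\<close>. In the
  induction, each occurring variable lowers the power, because the derivative of \<open>L\<close>
  along it is 1.\<close>

lemma divided_coeff_sum_power:
  fixes A :: "'v set"
  defines "L \<equiv> (\<Sum>i\<in>A. Var i) :: ('v, 'a::{comm_ring_1, semiring_char_0}) mpoly"
  assumes "finite A" "keys m \<subseteq> A" "mon_degree m = n"
  shows "divided_coeff (L ^ n) m = fact n"
  using assms(3,4)
proof (induction n arbitrary: m)
  case 0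
  then have "m = 0" by (intro poly_mapping_eqI) (auto simp: mon_degree_def in_keys_iff)
  then show ?case by (simp add: divided_coeff_def)
next
  case (Suc n)
  then have "keys m \<noteq> {}" by (auto simp: mon_degree_def)
  then obtain i where "i \<in> keys m" by blast
  then obtain m' where m: "m = m' + single i 1" by (rule obtain_add_single)
  have i: "i \<in> A" and m': "keys m' \<subseteq> A" "mon_degree m' = n"
    using Suc.prems \<open>i \<in> keys m\<close> by (auto simp: m mon_degree_add in_keys_iff lookup_add)
  have "partial i L = 1"
    using i assms(2) by (simp add: L_def partial_sum partial_Var)
  then have "divided_coeff (L ^ Suc n) m = divided_coeff (Const (of_nat (Suc n)) * L ^ n) m'"
    unfolding m divided_coeff_partial[symmetric] partial_power Const_of_nat by (simp only: mult_1_right)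
  with Suc.IH[OF m'] show ?case by (simp only: divided_coeff_Const_mult fact_Suc)
qed

section \<open>Comparison of coefficients of second derivatives\<close>

text \<open>\<open>G\<close> plays the role of the normalised divided coefficients of a form of
  degree \<open>e + 2\<close>. The same coefficient occurs in several second derivatives, and
  equating its values links the constants.\<close>

lemma second_difference_relations:
  fixes G :: "(nat \<Rightarrow>\<^sub>0 nat) \<Rightarrow> 'k::field_char_0" and a :: "nat \<Rightarrow> nat \<Rightarrow> 'k"
  assumes r: "r \<ge> 2" and e: "e \<ge> 1"
    and pure: "\<And>i m. i \<le> r \<Longrightarrow> mon_degree m = e \<Longrightarrow> keys m \<subseteq> {..r} \<Longrightarrow>
      G (m + single i 1 + single i 1) = b i + (if m = single i e then \<alpha> i else 0)"
    and mixed: "\<And>i j m. i \<le> r \<Longrightarrow> j \<le> r \<Longrightarrow> i \<noteq> j \<Longrightarrow> mon_degree m = e \<Longrightarrow> keys m \<subseteq> {..r} \<Longrightarrow>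
      G (m + single i 1 + single i 1) + G (m + single j 1 + single j 1) - 2 * G (m + single i 1 + single j 1) =
      (if m = single i e then a i j else 0) + (if m = single j e then a j i else 0)"
    and ij: "i \<le> r" "j \<le> r" "i \<noteq> j"
  shows "b i = b j" and "a i j = \<alpha> i"
proof -
  have ne: "m \<noteq> single k n" if "lookup m l \<noteq> 0" "l \<noteq> k" for m :: "nat \<Rightarrow>\<^sub>0 nat" and k l n
    using that by (auto simp: lookup_single when_def)
  have keys: "keys (m + n) \<subseteq> {..r}" if "keys m \<subseteq> {..r}" "keys n \<subseteq> {..r}" for m n :: "nat \<Rightarrow>\<^sub>0 nat"
    using keys_add[of m n] that by blast
  have step: "single k e = single k (e - 1) + single k 1" for k :: nat
    using e by (simp add: single_add[symmetric])
  \<comment> \<open>A third index is available because \<open>r \<ge> 2\<close>.\<close>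
  have "\<exists>k\<le>r. k \<noteq> i \<and> k \<noteq> j"
  proof -
    have "card ({..r} - {i, j}) \<noteq> 0" using r ij by (simp add: card_Diff_subset)
    then have "{..r} - {i, j} \<noteq> {}" by (metis card.empty)
    then show ?thesis by auto
  qed
  then obtain k where k: "k \<le> r" "k \<noteq> i" "k \<noteq> j" by blast
  \<comment> \<open>The coefficient of \<open>x_j^e x_i x_k\<close> is read twice: as the
    \<open>i, k\<close> derivative at \<open>x_j^e\<close> and as the \<open>j, k\<close> derivative
    at \<open>x_j^(e-1) x_i\<close>. Neither monomial is a pure power of one of the two variables of
    differentiation, so no correction terms appear.\<close>
  let ?m = "single j (e - 1) + single i 1"
  have m: "mon_degree ?m = e" "keys ?m \<subseteq> {..r}"
    using e ij by (simp add: mon_degree_add) (rule keys; use ij in simp)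
  have j: "mon_degree (single j e) = e" "keys (single j e) \<subseteq> {..r}"
    using ij by auto
  have "b i + b k = 2 * G (single j e + single i 1 + single k 1)"
    using mixed[OF ij(1) k(1) _ j] pure[OF ij(1) j] pure[OF k(1) j] k ij ne[of "single j e" j] e
    by (simp add: ne[of "single j e" j])
  also have "single j e + single i 1 + single k 1 = ?m + single j 1 + single k 1"
    unfolding step[of j] by (simp add: ac_simps)
  also have "2 * G (?m + single j 1 + single k 1) = b j + b k"
    using mixed[OF ij(2) k(1) _ m] pure[OF ij(2) m] pure[OF k(1) m] k ij
      ne[of ?m i j e] ne[of ?m i k e] by (simp add: lookup_add)
  finally show b: "b i = b j" by simp
  \<comment> \<open>The mixed term in the relation at \<open>x_i^e\<close> is the coefficient of
    \<open>x_i^(e+1) x_j\<close>, which is also the pure \<open>i, i\<close> coefficient at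
    \<open>x_i^(e-1) x_j\<close>.\<close>
  let ?m = "single i (e - 1) + single j 1"
  have m: "mon_degree ?m = e" "keys ?m \<subseteq> {..r}"
    using e ij by (simp add: mon_degree_add) (rule keys; use ij in simp)
  have i: "mon_degree (single i e) = e" "keys (single i e) \<subseteq> {..r}"
    using ij by auto
  have "G (single i e + single i 1 + single j 1) = G (?m + single i 1 + single i 1)"
    unfolding step[of i] by (simp add: ac_simps)
  also have "\<dots> = b i"
    using pure[OF ij(1) m] ij ne[of ?m j i e] by (simp add: lookup_add)
  finally show "a i j = \<alpha> i"
    using mixed[OF ij i] pure[OF ij(1) i] pure[OF ij(2) i] ij e b
    by (simp add: ne[of "single i e" i])
qed

text \<open>A monomial of degree at least 2 contains two variable factors, so its divided
  coefficient is one of a second derivative; in characteristic 0 the factorials can be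
  cancelled.\<close>

lemma second_derivatives_zero_imp_zero:
  fixes g :: "'k::field_char_0 poly_x"
  assumes g: "g \<in> forms (e + 2) r"
    and zero: "\<And>i j. i \<le> r \<Longrightarrow> j \<le> r \<Longrightarrow> partial i (partial j g) = 0"
  shows "g = 0"
proof (rule poly_mapping_eqI)
  fix m
  show "lookup g m = lookup 0 m"
  proof (rule ccontr)
    assume "lookup g m \<noteq> lookup 0 m"
    then have nz: "lookup g m \<noteq> 0" by simp
    then have deg: "mon_degree m = e + 2" and keys: "keys m \<subseteq> {..r}" using g by (auto simp: forms_iff)
    from deg have "keys m \<noteq> {}" by (auto simp: mon_degree_def)
    then obtain i n where i: "i \<in> keys m" and n: "m = n + single i 1"
      by (meson ex_in_conv obtain_add_single)
    have "mon_degree n = e + 1" using deg by (simp add: n mon_degree_add)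
    then have "keys n \<noteq> {}" by (auto simp: mon_degree_def)
    then obtain j n' where j: "j \<in> keys n" and n': "n = n' + single j 1"
      by (meson ex_in_conv obtain_add_single)
    have "j \<in> keys m" using j by (auto simp: n in_keys_iff lookup_add)
    with i keys have "partial j (partial i g) = 0" by (intro zero) auto
    then have "divided_coeff g m = 0"
      unfolding n n' divided_coeff_partial[symmetric] by (simp add: divided_coeff_def)
    then show False using nz by (simp add: divided_coeff_def)
  qed
qed

lemma sum_off_diagonal_swap:
  assumes "finite S"
  shows "(\<Sum>i\<in>S. \<Sum>j\<in>S - {i}. h i j) = (\<Sum>i\<in>S. \<Sum>j\<in>S - {i}. h j i)"
proof -
  have "(\<Sum>i\<in>S. \<Sum>j\<in>S - {i}. h i j) = (\<Sum>i\<in>S. \<Sum>j\<in>{j\<in>S. i \<noteq> j}. h i j)"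
    by (intro sum.cong refl) auto
  also have "\<dots> = (\<Sum>j\<in>S. \<Sum>i\<in>{i\<in>S. i \<noteq> j}. h i j)"
    using assms by (intro sum.swap_restrict)
  also have "\<dots> = (\<Sum>j\<in>S. \<Sum>i\<in>S - {j}. h i j)"
    by (intro sum.cong refl) auto
  finally show ?thesis .
qed

lemma add_self_eq_0: "a + a = 0 \<longleftrightarrow> a = (0::'a::{idom, ring_char_0})"
  by (simp flip: mult_2)

section \<open>Solving the adjugate equation\<close>

lemma adjugate_equation_imp_zero:
  fixes g :: "'k::field_char_0 poly_x" and r e :: nat
  defines "S \<equiv> {0..<r + 1}"
  defines "y \<equiv> (\<lambda>i. Var i ^ e :: 'k poly_x)" and "z \<equiv> (\<Sum>i\<in>S. Var i) ^ e"
    and "B \<equiv> (\<lambda>i j. partial i (partial j g))"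
  assumes r: "r \<ge> 2" and e: "e \<ge> 1" and g: "g \<in> forms (e + 2) r"
    and eq: "(\<Sum>i\<in>S. prod y (S - {i}) * B i i) +
      z * (\<Sum>i\<in>S. \<Sum>j\<in>S - {i}. prod y (S - {i, j}) * (B i i - B i j)) = 0"
  shows "g = 0"
proof -
  define H where "H i j = B i i + B j j - (B i j + B i j)" for i j
  define P where "P i = prod y (S - {i})" for i
  define P2 where "P2 i j = prod y (S - {i, j})" for i j
  define a where "a i j = lookup (H i j) (single i e)" for i j
  \<comment> \<open>The coefficient of \<open>z\<close> in \<open>B i i\<close>: it is forced by
    collecting the terms with \<open>P i\<close> once \<open>H\<close> is known. The remaining
    coefficient, of \<open>y i\<close>, is \<open>\<alpha> i\<close>.\<close>
  define b where "b i = - (\<Sum>j\<in>S - {i}. a j i)" for i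
  define \<alpha> where "\<alpha> i = lookup (B i i + Const (- b i) * z) (single i e)" for i
  have S [simp]: "finite S" by (simp add: S_def)
  have in_S: "i \<in> S \<longleftrightarrow> i \<le> r" for i by (auto simp: S_def)
  have B: "B i j \<in> forms e r" for i j
    unfolding B_def using g by (intro partial_in_forms) simp
  have B_commute: "B i j = B j i" for i j unfolding B_def by (rule partial_commute)
  have H: "H i j \<in> forms e r" for i j
    unfolding H_def by (intro forms_add forms_diff B)
  have H_commute: "H i j = H j i" for i j by (simp add: H_def B_commute[of j i])
  have P2_commute: "P2 i j = P2 j i" for i j by (simp add: P2_def insert_commute)
  have P2: "P j = y i * P2 i j" if "i \<in> S" "j \<in> S" "i \<noteq> j" for i j
    unfolding P_def P2_commute[of i] unfolding P2_def using that by (intro prod_remove2) auto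
  have z: "z \<in> forms e r"
    unfolding z_def using forms_power[OF forms_sum[OF Var_in_forms], of S "\<lambda>i. i" r e] by (simp add: in_S)
  \<comment> \<open>Doubling the equation and swapping the indices in one copy of the double sum
    makes it symmetric, with no ordering of the pairs.\<close>
  have eq2: "(\<Sum>i\<in>S. P i * (B i i + B i i)) + z * (\<Sum>i\<in>S. \<Sum>j\<in>S - {i}. P2 i j * H i j) = 0"
  proof -
    let ?T = "\<Sum>i\<in>S. \<Sum>j\<in>S - {i}. P2 i j * (B i i - B i j)"
    have "?T = (\<Sum>i\<in>S. \<Sum>j\<in>S - {i}. P2 j i * (B j j - B j i))"
      by (rule sum_off_diagonal_swap) simp
    then have "?T + ?T = (\<Sum>i\<in>S. \<Sum>j\<in>S - {i}. P2 i j * (B i i - B i j) + P2 j i * (B j j - B j i))"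
      by (simp add: sum.distrib)
    also have "\<dots> = (\<Sum>i\<in>S. \<Sum>j\<in>S - {i}. P2 i j * H i j)"
      by (intro sum.cong refl) (simp add: H_def P2_commute B_commute algebra_simps)
    finally have T: "(\<Sum>i\<in>S. \<Sum>j\<in>S - {i}. P2 i j * H i j) = ?T + ?T" ..
    have "(\<Sum>i\<in>S. P i * (B i i + B i i)) + z * (?T + ?T) =
        ((\<Sum>i\<in>S. P i * B i i) + z * ?T) + ((\<Sum>i\<in>S. P i * B i i) + z * ?T)"
      by (simp only: distrib_left sum.distrib add.assoc add.left_commute)
    also have "\<dots> = 0" using eq by (simp only: P_def P2_def add_0_left)
    finally show ?thesis unfolding T .
  qed
  \<comment> \<open>Modulo \<open>y i\<close> and \<open>y j\<close> only the pairs
    \<open>(i, j)\<close> and \<open>(j, i)\<close> survive in the equation; then \<open>z\<close>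
    and \<open>P2 i j\<close> are cancelled.\<close>
  have H_eq: "H i j = Const (a i j) * y i + Const (a j i) * y j"
    if ij: "i \<in> S" "j \<in> S" "i \<noteq> j" for i j
  proof -
    let ?N = "{m. \<forall>k\<in>{i, j}. lookup m k < e} :: (nat \<Rightarrow>\<^sub>0 nat) set"
    have down: "down_closed ?N" by (auto simp: down_closed_def lookup_add)
    have y: "vanishes_on ?N (y k)" if "k \<in> {i, j}" for k
      unfolding y_def using that by (intro vanishes_on_Var_power) auto
    have prod: "vanishes_on ?N (prod y T * q)" if "k \<in> T" "k \<in> {i, j}" "finite T" for T k q
      unfolding prod.remove[OF that(3,1)] mult.assoc by (rule vanishes_on_mult[OF down y[OF that(2)]])
    let ?h = "\<lambda>(k, l). P2 k l * H k l"
    have Sig: "(\<Sum>k\<in>S. \<Sum>l\<in>S - {k}. P2 k l * H k l) = (\<Sum>p\<in>(SIGMA k:S. S - {k}). ?h p)"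
      by (simp add: sum.Sigma)
    also have "\<dots> = (\<Sum>p\<in>{(i, j), (j, i)}. ?h p) + (\<Sum>p\<in>(SIGMA k:S. S - {k}) - {(i, j), (j, i)}. ?h p)"
      using ij by (subst sum.subset_diff[of "{(i, j), (j, i)}"]) (auto simp: add.commute)
    also have "(\<Sum>p\<in>{(i, j), (j, i)}. ?h p) = P2 i j * H i j + P2 i j * H i j"
      using ij by (simp add: P2_commute[of j] H_commute[of j])
    finally have Sig: "(\<Sum>k\<in>S. \<Sum>l\<in>S - {k}. P2 k l * H k l) = P2 i j * H i j + P2 i j * H i j +
        (\<Sum>p\<in>(SIGMA k:S. S - {k}) - {(i, j), (j, i)}. ?h p)" .
    have rearrange: "w * u = - (v + v' * w)" if "v + w * (u + v') = 0" for u v v' w :: "'k poly_x"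
      using that by (simp add: eq_neg_iff_add_eq_0 algebra_simps)
    have "z * (P2 i j * H i j + P2 i j * H i j) =
        - ((\<Sum>i\<in>S. P i * (B i i + B i i)) + (\<Sum>p\<in>(SIGMA k:S. S - {k}) - {(i, j), (j, i)}. ?h p) * z)"
      by (rule rearrange) (use eq2 in \<open>simp only: Sig\<close>)
    moreover have "vanishes_on ?N \<dots>"
      unfolding vanishes_on_uminus
    proof (rule vanishes_on_add[OF vanishes_on_sum vanishes_on_mult[OF down vanishes_on_sum]])
      \<comment> \<open>\<open>P k\<close> lacks only the factor \<open>y k\<close>, so it still
        contains \<open>y i\<close> or \<open>y j\<close>.\<close>
      fix k assume "k \<in> S"
      then show "vanishes_on ?N (P k * (B k k + B k k))"
        unfolding P_def using ij by (intro prod[of "if k = i then j else i"]) auto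
    next
      fix p assume "p \<in> (SIGMA k:S. S - {k}) - {(i, j), (j, i)}"
      then obtain k l where p: "p = (k, l)" "k \<noteq> l" "(k, l) \<noteq> (i, j)" "(k, l) \<noteq> (j, i)" by auto
      \<comment> \<open>A different pair misses \<open>i\<close> or \<open>j\<close>, and the
        corresponding factor remains in \<open>P2 k l\<close>.\<close>
      then have "i \<notin> {k, l} \<or> j \<notin> {k, l}" using ij by auto
      then have "vanishes_on ?N (P2 k l * H k l)"
      proof
        assume "i \<notin> {k, l}"
        then show ?thesis unfolding P2_def using ij by (intro prod[of i]) auto
      next
        assume "j \<notin> {k, l}"
        then show ?thesis unfolding P2_def using ij by (intro prod[of j]) auto
      qed
      then show "vanishes_on ?N (?h p)" by (simp add: p)
    qed
    ultimately have *: "vanishes_on ?N ((\<Sum>i\<in>S. Var i) ^ e * (P2 i j * (H i j + H i j)))"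
      by (simp only: z_def distrib_left)
    \<comment> \<open>Cancelling \<open>z\<close> requires a variable of the sum other than
      \<open>x_i\<close> and \<open>x_j\<close>.\<close>
    have "\<exists>k\<in>S. k \<notin> {i, j}"
    proof -
      have "card (S - {i, j}) \<noteq> 0" using r ij by (simp add: S_def card_Diff_subset)
      then have "S - {i, j} \<noteq> {}" by (metis card.empty)
      then show ?thesis by blast
    qed
    then obtain k where k: "k \<in> S" "k \<notin> {i, j}" by blast
    then have "m + single k 1 \<in> ?N" if "m \<in> ?N" for m
      using that by (simp add: lookup_add lookup_single)
    from vanishes_on_cancel_sum_power[OF down this k(1) S *]
    have "vanishes_on ?N (P2 i j * (H i j + H i j))" .
    then have "vanishes_on ?N (H i j + H i j)"
      unfolding P2_def y_def
      by (rule vanishes_on_cancel_prod[rotated 2]) (auto simp: lookup_add lookup_single)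
    then have "vanishes_on ?N (H i j)"
      unfolding vanishes_on_def lookup_add by (simp only: add_self_eq_0)
    from form_eq_sum_Var_power[OF H e _ this] show ?thesis
      using ij by (simp add: a_def y_def H_commute[of j])
  qed
  \<comment> \<open>Since \<open>y i * P2 i j = P j\<close>, inserting \<open>H_eq\<close> leaves a
    combination of the \<open>P i\<close> alone; by symmetry its two halves agree.\<close>
  have eq3: "(\<Sum>i\<in>S. P i * (B i i - Const (b i) * z)) = 0"
  proof -
    have "(\<Sum>i\<in>S. \<Sum>j\<in>S - {i}. P2 i j * H i j) =
        (\<Sum>i\<in>S. \<Sum>j\<in>S - {i}. Const (a i j) * P j + Const (a j i) * P i)"
    proof (intro sum.cong refl)
      fix i j assume "i \<in> S" "j \<in> S - {i}"
      then show "P2 i j * H i j = Const (a i j) * P j + Const (a j i) * P i"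
        using P2[of i j] P2[of j i] by (simp add: H_eq P2_commute[of j] algebra_simps)
    qed
    also have "\<dots> = (\<Sum>i\<in>S. \<Sum>j\<in>S - {i}. Const (a i j) * P j) + (\<Sum>i\<in>S. \<Sum>j\<in>S - {i}. Const (a j i) * P i)"
      by (simp only: sum.distrib)
    also have "(\<Sum>i\<in>S. \<Sum>j\<in>S - {i}. Const (a i j) * P j) = (\<Sum>i\<in>S. \<Sum>j\<in>S - {i}. Const (a j i) * P i)"
      by (rule sum_off_diagonal_swap) simp
    also have "(\<Sum>i\<in>S. \<Sum>j\<in>S - {i}. Const (a j i) * P i) = - (\<Sum>i\<in>S. P i * Const (b i))"
      by (simp add: b_def Const_uminus Const_sum sum_distrib_left sum_negf mult.commute)
    finally have T: "(\<Sum>i\<in>S. \<Sum>j\<in>S - {i}. P2 i j * H i j) =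
        - (\<Sum>i\<in>S. P i * Const (b i)) - (\<Sum>i\<in>S. P i * Const (b i))" by simp
    have halve: "u - z * w = 0" if "(u + u) + z * (- w - w) = 0" for u w :: "'k poly_x"
    proof -
      have "(u - z * w) + (u - z * w) = 0" using that by (simp add: algebra_simps)
      then show ?thesis by (simp only: add_self_eq_0)
    qed
    have "(\<Sum>i\<in>S. P i * B i i) - z * (\<Sum>i\<in>S. P i * Const (b i)) = 0"
      using eq2 unfolding T distrib_left[of "P _"] sum.distrib by (rule halve)
    then show ?thesis
      by (simp only: right_diff_distrib sum_subtractf sum_distrib_left mult_ac)
  qed
  \<comment> \<open>Modulo \<open>y i\<close>, every \<open>P k\<close> with
    \<open>k \<noteq> i\<close> vanishes, and \<open>P i\<close> can be cancelled.\<close>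
  have B_eq: "B i i = Const (b i) * z + Const (\<alpha> i) * y i" if i: "i \<in> S" for i
  proof -
    let ?N = "{m. \<forall>k\<in>{i}. lookup m k < e} :: (nat \<Rightarrow>\<^sub>0 nat) set"
    have down: "down_closed ?N" by (auto simp: down_closed_def lookup_add)
    have y: "vanishes_on ?N (y i)"
      unfolding y_def by (intro vanishes_on_Var_power) auto
    have "P i * (B i i - Const (b i) * z) = - (\<Sum>k\<in>S - {i}. P k * (B k k - Const (b k) * z))"
      using eq3 i by (simp only: sum.remove[OF S i] eq_neg_iff_add_eq_0)
    moreover have "vanishes_on ?N \<dots>"
      unfolding vanishes_on_uminus
    proof (rule vanishes_on_sum)
      fix k assume k: "k \<in> S - {i}"
      then have "P k = y i * P2 i k" using i by (intro P2) auto
      then show "vanishes_on ?N (P k * (B k k - Const (b k) * z))"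
        using vanishes_on_mult[OF down y] by (simp only: mult.assoc)
    qed
    ultimately have "vanishes_on ?N (P i * (B i i - Const (b i) * z))" by simp
    then have "vanishes_on ?N (B i i - Const (b i) * z)"
      unfolding P_def y_def
      by (rule vanishes_on_cancel_prod[rotated 2]) (auto simp: lookup_add lookup_single)
    then have "B i i + Const (- b i) * z = Const (\<alpha> i) * y i"
      using form_eq_sum_Var_power[of "B i i + Const (- b i) * z" e r "{i}"] e B z
      by (simp add: \<alpha>_def y_def Const_uminus forms_diff forms_Const_mult)
    then show ?thesis by (simp add: Const_uminus algebra_simps)
  qed
  \<comment> \<open>Both \<open>y i\<close>, at its own monomial, and \<open>z\<close>, at every
    monomial of degree \<open>e\<close> in the variables, have divided coefficient
    \<open>fact e\<close>; the division normalises these to 1.\<close>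
  define G where "G m = divided_coeff g m / fact e" for m
  have pure: "G (m + single i 1 + single i 1) = b i + (if m = single i e then \<alpha> i else 0)"
    if "i \<le> r" "mon_degree m = e" "keys m \<subseteq> {..r}" for i m
  proof -
    have "divided_coeff g (m + single i 1 + single i 1) = divided_coeff (B i i) m"
      by (simp only: B_def divided_coeff_partial)
    also have "\<dots> = b i * fact e + \<alpha> i * (if m = single i e then fact e else 0)"
    proof -
      have "divided_coeff z m = fact e"
        unfolding z_def using that by (intro divided_coeff_sum_power) (auto simp: in_S)
      moreover have "i \<in> S" using that by (simp add: in_S)
      ultimately show ?thesis
        unfolding B_eq[OF \<open>i \<in> S\<close>] y_def
        by (simp only: divided_coeff_add divided_coeff_Const_mult divided_coeff_Var_power)
    qed
    also have "\<dots> = (b i + (if m = single i e then \<alpha> i else 0)) * fact e"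
      by (simp add: distrib_right)
    finally show ?thesis by (simp add: G_def)
  qed
  have mixed: "G (m + single i 1 + single i 1) + G (m + single j 1 + single j 1) - 2 * G (m + single i 1 + single j 1) =
      (if m = single i e then a i j else 0) + (if m = single j e then a j i else 0)"
    if "i \<le> r" "j \<le> r" "i \<noteq> j" for i j m
  proof -
    have "divided_coeff g (m + single i 1 + single i 1) + divided_coeff g (m + single j 1 + single j 1) -
        2 * divided_coeff g (m + single i 1 + single j 1) = divided_coeff (H i j) m"
      by (simp only: H_def B_def divided_coeff_partial divided_coeff_add divided_coeff_diff mult_2)
    also have "\<dots> = ((if m = single i e then a i j else 0) + (if m = single j e then a j i else 0)) * fact e"
    proof -
      have "i \<in> S" "j \<in> S" using that by (simp_all add: in_S)
      then show ?thesis
        unfolding H_eq[OF \<open>i \<in> S\<close> \<open>j \<in> S\<close> \<open>i \<noteq> j\<close>] y_def divided_coeff_add divided_coeff_Const_mult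
          divided_coeff_Var_power distrib_right
        by (cases "m = single i e"; cases "m = single j e")
          simp_all
    qed
    finally have "(divided_coeff g (m + single i 1 + single i 1) + divided_coeff g (m + single j 1 + single j 1) -
        2 * divided_coeff g (m + single i 1 + single j 1)) / fact e =
        (if m = single i e then a i j else 0) + (if m = single j e then a j i else 0)"
      by simp
    then show ?thesis
      by (simp only: G_def diff_divide_distrib add_divide_distrib times_divide_eq_right)
  qed
  have rel: "b i = b j" "a i j = \<alpha> i" if "i \<le> r" "j \<le> r" "i \<noteq> j" for i j
    by (rule second_difference_relations[where G = G and b = b and \<alpha> = \<alpha> and a = a and i = i and j = j,
          OF r e]; (rule pure mixed that; assumption)?; fact that)+
  have b_const: "b i = b 0" if "i \<le> r" for i
    using rel(1)[of i 0] that by (cases "i = 0") auto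
  \<comment> \<open>Inserting \<open>B_eq\<close> into \<open>eq3\<close> leaves
    \<open>prod y S\<close> times the sum of the \<open>\<alpha> i\<close>, so that sum is
    0.\<close>
  have "(\<Sum>i\<in>S. P i * (B i i - Const (b i) * z)) = prod y S * Const (\<Sum>i\<in>S. \<alpha> i)"
  proof -
    have "P i * (B i i - Const (b i) * z) = prod y S * Const (\<alpha> i)" if "i \<in> S" for i
      using prod.remove[OF S that, of y] B_eq[OF that] by (simp add: P_def mult_ac)
    then show ?thesis by (simp add: Const_sum sum_distrib_left)
  qed
  moreover have "eval (\<lambda>_. 1) (prod y S) = 1"
    by (simp add: y_def eval_prod eval_power)
  then have "prod y S \<noteq> 0" by (metis eval_0 zero_neq_one)
  ultimately have sum_\<alpha>: "(\<Sum>i\<in>S. \<alpha> i) = 0" using eq3 by simp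
  \<comment> \<open>With \<open>a j i = \<alpha> j\<close>, the definition of \<open>b i\<close> is
    minus the sum of all \<open>\<alpha> j\<close> except \<open>\<alpha> i\<close>. Hence all
    \<open>\<alpha> i\<close> equal \<open>b 0\<close>, and their sum \<open>(r + 1) * b 0\<close>
    is 0.\<close>
  have b_\<alpha>: "\<alpha> i = b i" if "i \<le> r" for i
  proof -
    have "b i = - (\<Sum>j\<in>S - {i}. \<alpha> j)"
      unfolding b_def using that by (intro arg_cong[of _ _ uminus] sum.cong refl rel(2)) (auto simp: in_S)
    also have "\<dots> = \<alpha> i" using sum_\<alpha> sum.remove[OF S, of i \<alpha>] that
      by (simp add: in_S neg_eq_iff_add_eq_0 add.commute)
    finally show ?thesis ..
  qed
  then have "(\<Sum>i\<in>S. \<alpha> i) = (\<Sum>i\<in>S. b 0)"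
    by (intro sum.cong refl) (metis b_const in_S)
  with sum_\<alpha> have "of_nat (r + 1) * b 0 = 0" by (simp add: S_def)
  then have "b 0 = 0" by (simp only: mult_eq_0_iff of_nat_eq_0_iff) simp
  then have b0: "b i = 0" and \<alpha>0: "\<alpha> i = 0" if "i \<le> r" for i
    using trans[OF b_const[OF that]] trans[OF b_\<alpha>[OF that] trans[OF b_const[OF that]]] by blast+
  have Bii: "B i i = 0" if "i \<le> r" for i
    by (simp only: B_eq[OF iffD2[OF in_S that]] b0[OF that] \<alpha>0[OF that] Const_0 mult_zero_left add_0)
  show ?thesis
  proof (rule second_derivatives_zero_imp_zero[OF g])
    fix i j assume ij: "i \<le> r" "j \<le> r"
    show "partial i (partial j g) = 0"
    proof (cases "i = j")
      case False
      have "H i j = 0"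
        using H_eq[of i j] rel(2)[OF ij False] rel(2)[OF ij(2,1) False[symmetric]] \<alpha>0 ij False
        by (simp only: in_S Const_0 mult_zero_left add_0 simp_thms)
      then have "B i j + B i j = 0" using Bii[OF ij(1)] Bii[OF ij(2)] by (simp add: H_def)
      then show ?thesis by (simp only: B_def add_self_eq_0)
    qed (use Bii[OF ij(1)] in \<open>simp add: B_def\<close>)
  qed
qed

lemma power_sum_immersive:
  fixes f g :: "'k::field_char_0 poly_x"
  assumes r: "r \<ge> 2" and e: "e \<ge> 1"
    and f: "f = (\<Sum>i<r + 1. Var i ^ (e + 2)) + (\<Sum>i<r + 1. Var i) ^ (e + 2)"
    and g: "g \<in> forms (e + 2) r" and zero: "hess_deriv r f g = 0"
  shows "g = 0"
proof -
  define S where "S = {0..<r + 1}"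
  define y :: "nat \<Rightarrow> 'k poly_x" where "y = (\<lambda>i. Var i ^ e)"
  define z :: "'k poly_x" where "z = (\<Sum>i\<in>S. Var i) ^ e"
  define c :: "'k poly_x" where "c = of_nat ((e + 2) * (e + 1))"
  have L: "(\<Sum>i\<in>S. Var i :: 'k poly_x) \<in> forms 1 r"
    by (intro forms_sum Var_in_forms) (simp add: S_def)
  have f2: "partial i (partial j f) = c * ((if i = j then y i else 0) + z)" if ij: "i < r + 1" "j < r + 1" for i j
  proof -
    have "partial i (\<Sum>i\<in>S. Var i :: 'k poly_x) = 1" if "i < r + 1" for i
      using that by (simp add: S_def partial_sum partial_Var del: sum.op_ivl_Suc)
    then have "partial i (partial j ((\<Sum>i\<in>S. Var i) ^ (e + 2))) = c * z"
      using ij by (simp only: partial_partial_power[OF L] c_def z_def mult_1_left mult_1_right)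
    moreover have "partial i (partial j (\<Sum>k\<in>S. Var k ^ (e + 2))) = (if i = j then c * y i else 0)"
    proof -
      have "partial i (partial j (\<Sum>k\<in>S. Var k ^ (e + 2))) =
          (\<Sum>k\<in>S. partial i (Var k) * (c * y k) * partial j (Var k))"
        unfolding partial_sum c_def y_def
        by (intro sum.cong refl partial_partial_power[where r = r] Var_in_forms) (simp add: S_def)
      also have "\<dots> = (\<Sum>k\<in>S. if k = i then (if i = j then c * y i else 0) else 0)"
        by (intro sum.cong refl) (auto simp: partial_Var)
      finally show ?thesis using ij by (simp add: S_def)
    qed
    ultimately show ?thesis
      unfolding f lessThan_atLeast0 S_def[symmetric] partial_add
      by (simp add: distrib_left)
  qed
  \<comment> \<open>The determinant factor is nonzero because its value at the point
    \<open>(1, ..., 1)\<close> is a positive integer, in characteristic 0.\<close>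
  have "eval (\<lambda>_. 1) (prod y S + z * (\<Sum>i\<in>S. prod y (S - {i}))) = of_nat (1 + (r + 1) ^ e * (r + 1))"
    by (simp add: eval_add eval_mult eval_prod eval_sum eval_power y_def z_def S_def algebra_simps)
  also have "\<dots> \<noteq> 0" unfolding of_nat_eq_0_iff by simp
  finally have "prod y S + z * (\<Sum>i\<in>S. prod y (S - {i})) \<noteq> 0" by auto
  moreover have "c \<noteq> 0" unfolding c_def of_nat_eq_0_iff by simp
  moreover have "ddet (r + 1) (\<lambda>i j. c * ((if i = j then y i else 0) + z)) (\<lambda>i j. partial i (partial j g)) = 0"
    using zero f2 unfolding hess_deriv_eq_ddet by (subst (asm) ddet_cong) auto
  ultimately show ?thesis
    unfolding S_def y_def z_def
    by (intro adjugate_equation_imp_zero[OF r e g] ddet_diag_plus_const)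
qed

section \<open>Openness of injectivity\<close>

text \<open>The degree is recorded because only homogeneous polynomials in the coefficients define
  open sets of \<open>zariski\<close>.\<close>

definition form_function :: "nat \<Rightarrow> ('a::field poly_x \<Rightarrow> 'a) \<Rightarrow> bool" where
  "form_function e \<phi> \<longleftrightarrow> (\<exists>F. homogeneous e F \<and> (\<forall>p. eval (lookup p) F = \<phi> p))"

lemma form_function_const: "form_function 0 (\<lambda>_. c)"
  unfolding form_function_def by (intro exI[of _ "Const c"]) (simp add: homogeneous_Const)

lemma form_function_0: "form_function e (\<lambda>_. 0)"
  unfolding form_function_def by (intro exI[of _ 0]) (simp add: homogeneous_def)

lemma form_function_lookup: "form_function 1 (\<lambda>p. lookup p m)"
  unfolding form_function_def by (intro exI[of _ "Var m"]) (simp add: homogeneous_Var[simplified])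

lemma form_function_add: "form_function e \<phi> \<Longrightarrow> form_function e \<psi> \<Longrightarrow> form_function e (\<lambda>p. \<phi> p + \<psi> p)"
  unfolding form_function_def by (metis homogeneous_add eval_add)

lemma form_function_mult:
  "form_function d \<phi> \<Longrightarrow> form_function e \<psi> \<Longrightarrow> form_function (d + e) (\<lambda>p. \<phi> p * \<psi> p)"
  unfolding form_function_def by (metis homogeneous_mult eval_mult)

lemma form_function_cmult: "form_function e \<phi> \<Longrightarrow> form_function e (\<lambda>p. c * \<phi> p)"
  using form_function_mult[OF form_function_const] by simp

lemma form_function_sum:
  "(\<And>x. x \<in> A \<Longrightarrow> form_function e (\<phi> x)) \<Longrightarrow> form_function e (\<lambda>p. \<Sum>x\<in>A. \<phi> x p)"
  by (induction A rule: infinite_finite_induct) (auto intro: form_function_0 form_function_add)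

lemma form_function_prod:
  "finite A \<Longrightarrow> (\<And>x. x \<in> A \<Longrightarrow> form_function e (\<phi> x)) \<Longrightarrow> form_function (card A * e) (\<lambda>p. \<Prod>x\<in>A. \<phi> x p)"
  by (induction A rule: finite_induct) (auto intro: form_function_const form_function_mult)

lemma form_function_det:
  assumes "\<And>i j. form_function e (\<phi> i j)"
  shows "form_function (n * e) (\<lambda>p. Determinant.det (Matrix.mat n n (\<lambda>(i,j). \<phi> i j p)))"
proof -
  have "form_function (n * e) (\<lambda>q. \<Prod>i = 0..<n. \<phi> i (p i) q)" for p
    using form_function_prod[of "{0..<n}" e "\<lambda>i. \<phi> i (p i)"] assms by simp
  then show ?thesis
    unfolding det_mat_eq by (intro form_function_sum form_function_cmult)
qed

definition form_map :: "nat \<Rightarrow> ('a::field poly_x \<Rightarrow> 'a poly_x) \<Rightarrow> bool" where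
  "form_map e \<Phi> \<longleftrightarrow> (\<forall>m. form_function e (\<lambda>p. lookup (\<Phi> p) m))"

lemma form_map_id: "form_map 1 (\<lambda>p. p)"
  unfolding form_map_def using form_function_lookup by blast

lemma form_map_const: "form_map 0 (\<lambda>_. q)"
  by (simp add: form_map_def form_function_const)

lemma form_map_0: "form_map e (\<lambda>_. 0)"
  by (simp add: form_map_def form_function_0)

lemma form_map_add: "form_map e \<Phi> \<Longrightarrow> form_map e \<Psi> \<Longrightarrow> form_map e (\<lambda>p. \<Phi> p + \<Psi> p)"
  by (simp add: form_map_def lookup_add form_function_add)

lemma form_map_mult: "form_map d \<Phi> \<Longrightarrow> form_map e \<Psi> \<Longrightarrow> form_map (d + e) (\<lambda>p. \<Phi> p * \<Psi> p)"
  by (simp add: form_map_def lookup_mult_sum form_function_sum form_function_mult)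

lemma form_map_cmult: "form_map e \<Phi> \<Longrightarrow> form_map e (\<lambda>p. q * \<Phi> p)"
  using form_map_mult[OF form_map_const] by simp

lemma form_map_sum:
  "(\<And>x. x \<in> A \<Longrightarrow> form_map e (\<Phi> x)) \<Longrightarrow> form_map e (\<lambda>p. \<Sum>x\<in>A. \<Phi> x p)"
  by (induction A rule: infinite_finite_induct) (auto intro: form_map_0 form_map_add)

lemma form_map_prod:
  "finite A \<Longrightarrow> (\<And>x. x \<in> A \<Longrightarrow> form_map e (\<Phi> x)) \<Longrightarrow> form_map (card A * e) (\<lambda>p. \<Prod>x\<in>A. \<Phi> x p)"
  by (induction A rule: finite_induct) (auto intro: form_map_const form_map_mult)

lemma form_map_partial: "form_map e \<Phi> \<Longrightarrow> form_map e (\<lambda>p. partial i (\<Phi> p))"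
  by (simp add: form_map_def lookup_partial form_function_cmult)

text \<open>Of the \<open>r + 1\<close> matrix entries in each term, one comes from
  \<open>g\<close>; the other \<open>r\<close> are linear in \<open>q\<close>.\<close>

lemma form_map_hess_deriv: "form_map r (\<lambda>q. hess_deriv r q g)"
proof -
  have "form_map r (\<lambda>q. \<Prod>j\<in>{0..<r + 1} - {i}. partial j (partial (p j) q))" if "i < r + 1" for p i
  proof -
    have "card ({0..<r + 1} - {i}) = r" using that by (simp add: card_Diff_subset)
    then show ?thesis
      using form_map_prod[of "{0..<r + 1} - {i}" 1 "\<lambda>j q. partial j (partial (p j) q)"]
      by (simp add: form_map_partial form_map_id[simplified])
  qed
  then show ?thesis
    unfolding hess_deriv_eq_ddet ddet_def
    by (intro form_map_sum form_map_cmult) auto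
qed

text \<open>A linear left inverse \<open>T\<close> of the derivative at \<open>f\<close> is kept
  fixed. The determinant of \<open>T\<close> composed with the derivative at \<open>q\<close>, in
  the monomial basis and truncated to finitely many output monomials, is a form in the coefficients
  of \<open>q\<close> with value 1 at \<open>f\<close>.\<close>

lemma immersive_open:
  fixes f :: "'k::field poly_x"
  assumes "\<And>g. g \<in> forms d r \<Longrightarrow> hess_deriv r f g = 0 \<Longrightarrow> g = 0"
  obtains e F where "homogeneous e F" "eval (lookup f) F \<noteq> 0"
    "\<And>q g. eval (lookup q) F \<noteq> 0 \<Longrightarrow> g \<in> forms d r \<Longrightarrow> hess_deriv r q g = 0 \<Longrightarrow> g = 0"
proof -
  let ?scale = "\<lambda>c (p :: 'k poly_x). Const c * p"
  interpret vector_space_pair ?scale ?scale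
    by unfold_locales (simp_all add: Const_add Const_mult Const_1 algebra_simps)
  have lin: "Vector_Spaces.linear ?scale ?scale (hess_deriv r f)"
    by unfold_locales (simp_all add: hess_deriv_add hess_deriv_Const_mult)
  have sub: "vs1.subspace (forms d r)"
    by (rule vs1.subspaceI) (auto intro: forms_add forms_Const_mult)
  have "inj_on (hess_deriv r f) (forms d r)"
    unfolding linear_inj_on_iff_eq_0[OF lin sub] using assms by blast
  then obtain T where T: "Vector_Spaces.linear ?scale ?scale T"
      "\<And>g. g \<in> forms d r \<Longrightarrow> T (hess_deriv r f g) = g"
    using linear_exists_left_inverse_on[OF lin sub] by blast
  interpret T: Vector_Spaces.linear ?scale ?scale T by (rule T(1))

  let ?M = "{m :: nat \<Rightarrow>\<^sub>0 nat. mon_degree m = d \<and> keys m \<subseteq> {..r}}"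
  define n where "n = card ?M"
  obtain h where h: "bij_betw h {0..<n} ?M"
    using ex_bij_betw_nat_finite[OF finite_forms_monomials] unfolding n_def by blast
  define x where "x j = (single (h j) 1 :: 'k poly_x)" for j
  have x: "x j \<in> forms d r" if "j < n" for j
    using bij_betwE[OF h] that by (auto simp: x_def forms_iff lookup_single when_def)
  have expand: "g = (\<Sum>j = 0..<n. Const (lookup g (h j)) * x j)" if "g \<in> forms d r" for g
  proof -
    have "g = (\<Sum>m\<in>keys g. single m (lookup g m))" by (rule poly_mapping_sum_single)
    also have "\<dots> = (\<Sum>m\<in>?M. single m (lookup g m))"
      using that by (intro sum.mono_neutral_left finite_forms_monomials) (auto simp: forms_iff in_keys_iff)
    also have "\<dots> = (\<Sum>j = 0..<n. single (h j) (lookup g (h j)))"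
      by (rule sum.reindex_bij_betw[OF h, symmetric])
    finally show ?thesis by (simp add: x_def Const_def mult_single)
  qed
  \<comment> \<open>All monomials that occur at \<open>f\<close>, so that the truncation to
    \<open>K\<close> changes nothing there. At other \<open>q\<close> it may, but the kernel of the
    derivative is still annihilated by the matrix \<open>A\<close>.\<close>
  define K where "K = (\<Union>j<n. keys (hess_deriv r f (x j)))"
  define A where "A i j q = (\<Sum>k\<in>K. lookup (T (single k 1)) (h i) * lookup (hess_deriv r q (x j)) k)" for i j q
  have "form_function (n * r) (\<lambda>q. Determinant.det (Matrix.mat n n (\<lambda>(i,j). A i j q)))"
    unfolding A_def using form_map_hess_deriv[unfolded form_map_def]
    by (intro form_function_det form_function_sum form_function_cmult) blast
  then obtain F where F: "homogeneous (n * r) F"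
      "\<And>q. eval (lookup q) F = Determinant.det (Matrix.mat n n (\<lambda>(i,j). A i j q))"
    unfolding form_function_def by blast
  have A_f: "A i j f = (if i = j then 1 else 0)" if ij: "i < n" "j < n" for i j
  proof -
    have "hess_deriv r f (x j) = (\<Sum>k\<in>keys (hess_deriv r f (x j)). single k (lookup (hess_deriv r f (x j)) k))"
      by (rule poly_mapping_sum_single)
    also have "\<dots> = (\<Sum>k\<in>K. single k (lookup (hess_deriv r f (x j)) k))"
      using ij by (intro sum.mono_neutral_left) (auto simp: K_def in_keys_iff)
    also have "\<dots> = (\<Sum>k\<in>K. Const (lookup (hess_deriv r f (x j)) k) * single k 1)"
      by (simp add: Const_def mult_single)
    finally have "x j = T (\<Sum>k\<in>K. Const (lookup (hess_deriv r f (x j)) k) * single k 1)"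
      using T(2)[OF x[OF ij(2)]] by simp
    also have "\<dots> = (\<Sum>k\<in>K. Const (lookup (hess_deriv r f (x j)) k) * T (single k 1))"
      by (simp add: T.sum T.scale)
    finally have *: "x j = (\<Sum>k\<in>K. Const (lookup (hess_deriv r f (x j)) k) * T (single k 1))" .
    have "lookup (x j) (h i) = A i j f"
      by (subst *) (simp add: lookup_sum lookup_Const_mult A_def mult.commute[of "lookup (T _) _"])
    moreover have "h i = h j \<longleftrightarrow> i = j"
      using h ij by (auto simp: bij_betw_def inj_on_def)
    ultimately show ?thesis by (auto simp: x_def lookup_single when_def)
  qed
  have "Matrix.mat n n (\<lambda>(i,j). A i j f) = 1\<^sub>m n"
    by (rule eq_matI) (auto simp: A_f)
  then have "eval (lookup f) F \<noteq> 0" by (simp add: F)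
  moreover have "g = 0" if q: "eval (lookup q) F \<noteq> 0" and g: "g \<in> forms d r" "hess_deriv r q g = 0" for q g
  proof -
    have hd: "hess_deriv r q (\<Sum>j\<in>J. Const (c j) * x j) = (\<Sum>j\<in>J. Const (c j) * hess_deriv r q (x j))"
      for c and J :: "nat set"
      by (induction J rule: infinite_finite_induct)
        (simp_all add: hess_deriv_0 hess_deriv_add hess_deriv_Const_mult)
    define v where "v = Matrix.vec n (\<lambda>j. lookup g (h j))"
    have "(\<Sum>j = 0..<n. A i j q * lookup g (h j)) = 0" for i
    proof -
      have "(\<Sum>j = 0..<n. A i j q * lookup g (h j)) =
          (\<Sum>k\<in>K. lookup (T (single k 1)) (h i) * lookup (\<Sum>j = 0..<n. Const (lookup g (h j)) * hess_deriv r q (x j)) k)"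
        unfolding A_def sum_distrib_right lookup_sum lookup_Const_mult sum_distrib_left
        by (subst sum.swap) (simp add: mult_ac)
      also have "(\<Sum>j = 0..<n. Const (lookup g (h j)) * hess_deriv r q (x j)) = 0"
        unfolding hd[symmetric] expand[OF g(1), symmetric] by (rule g(2))
      finally show ?thesis by simp
    qed
    then have "Matrix.mat n n (\<lambda>(i,j). A i j q) *\<^sub>v v = 0\<^sub>v n"
      by (intro eq_vecI) (auto simp: v_def scalar_prod_def)
    moreover have "v \<in> carrier_vec n" by (simp add: v_def)
    ultimately have "v = 0\<^sub>v n"
      using q det_0_iff_vec_prod_zero[of "Matrix.mat n n (\<lambda>(i,j). A i j q)" n] by (auto simp: F)
    then have "lookup g (h j) = 0" if "j < n" for j
      using that by (metis v_def index_vec index_zero_vec(1))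
    then show "g = 0" by (subst expand[OF g(1)]) (simp add: Const_0)
  qed
  ultimately show thesis using F(1) that by blast
qed

section \<open>The general point\<close>

lemma eval_scale:
  assumes "homogeneous e F"
  shows "eval (\<lambda>m. c * x m) F = c ^ e * eval x F"
proof -
  have "(\<Prod>i\<in>keys m. (c * x i) ^ lookup m i) = c ^ e * (\<Prod>i\<in>keys m. x i ^ lookup m i)" if "m \<in> keys F" for m
  proof -
    have "(\<Prod>i\<in>keys m. (c * x i) ^ lookup m i) = c ^ mon_degree m * (\<Prod>i\<in>keys m. x i ^ lookup m i)"
      by (simp add: power_mult_distrib prod.distrib mon_degree_def power_sum)
    with that assms show ?thesis by (simp add: homogeneous_def)
  qed
  then show ?thesis
    unfolding eval_def by (simp add: sum_distrib_left mult.left_commute)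
qed

text \<open>By homogeneity, whether \<open>F\<close> vanishes does not depend on the
  representative.\<close>

lemma proj_class_in_zariski_basic_iff:
  fixes f :: "'k::field poly_x"
  assumes "homogeneous e F" "f \<in> forms d r" "f \<noteq> 0"
  shows "proj_class f \<in> zariski_basic d r F \<longleftrightarrow> eval (lookup f) F \<noteq> 0"
proof
  assume "proj_class f \<in> zariski_basic d r F"
  then obtain g where g: "proj_class f = proj_class g" "eval (lookup g) F \<noteq> 0"
    by (auto simp: zariski_basic_def)
  have "g \<in> proj_class g"
    unfolding proj_class_def by (intro CollectI exI[of _ 1]) (simp add: Const_1)
  then obtain c where "g = Const c * f" unfolding g(1)[symmetric] by (auto simp: proj_class_def)
  then have "lookup g = (\<lambda>m. c * lookup f m)" by (auto simp: lookup_Const_mult)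
  with g(2) show "eval (lookup f) F \<noteq> 0" by (auto simp: eval_scale[OF assms(1)])
next
  assume "eval (lookup f) F \<noteq> 0"
  with assms show "proj_class f \<in> zariski_basic d r F" by (auto simp: zariski_basic_def)
qed

lemma topspace_zariski:
  "topspace (zariski d r :: 'k::field poly_x set topology) = Sigma_space d r"
proof -
  have "zariski_basic d r F \<subseteq> Sigma_space d r" for F :: "(nat \<Rightarrow>\<^sub>0 nat, 'k) mpoly"
    by (auto simp: zariski_basic_def Sigma_space_def)
  moreover have "zariski_basic d r (Const 1) = (Sigma_space d r :: 'k poly_x set set)"
    by (auto simp: zariski_basic_def Sigma_space_def)
  ultimately show ?thesis
    unfolding zariski_def topology_generated_by_topspace
    using homogeneous_Const[of "1::'k"] by (intro equalityI) blast+
qed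

section \<open>Polynomial curves in the space of forms\<close>

definition polynomial_function :: "('k::field \<Rightarrow> 'k) \<Rightarrow> bool" where
  "polynomial_function \<phi> \<longleftrightarrow> (\<exists>P. \<forall>t. \<phi> t = poly P t)"

lemma polynomial_function_const: "polynomial_function (\<lambda>_. c)"
  unfolding polynomial_function_def by (intro exI[of _ "[:c:]"]) simp

lemma polynomial_function_linear: "polynomial_function (\<lambda>t. a + t * b)"
  unfolding polynomial_function_def by (intro exI[of _ "[:a, b:]"]) simp

lemma polynomial_function_add:
  "polynomial_function \<phi> \<Longrightarrow> polynomial_function \<psi> \<Longrightarrow> polynomial_function (\<lambda>t. \<phi> t + \<psi> t)"
  unfolding polynomial_function_def by (metis poly_add)

lemma polynomial_function_mult:
  "polynomial_function \<phi> \<Longrightarrow> polynomial_function \<psi> \<Longrightarrow> polynomial_function (\<lambda>t. \<phi> t * \<psi> t)"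
  unfolding polynomial_function_def by (metis poly_mult)

lemma polynomial_function_power: "polynomial_function \<phi> \<Longrightarrow> polynomial_function (\<lambda>t. \<phi> t ^ n)"
  unfolding polynomial_function_def by (metis poly_power)

lemma polynomial_function_sum:
  "(\<And>x. x \<in> A \<Longrightarrow> polynomial_function (\<phi> x)) \<Longrightarrow> polynomial_function (\<lambda>t. \<Sum>x\<in>A. \<phi> x t)"
  by (induction A rule: infinite_finite_induct)
    (auto intro: polynomial_function_const polynomial_function_add)

lemma polynomial_function_prod:
  "(\<And>x. x \<in> A \<Longrightarrow> polynomial_function (\<phi> x)) \<Longrightarrow> polynomial_function (\<lambda>t. \<Prod>x\<in>A. \<phi> x t)"
  by (induction A rule: infinite_finite_induct)
    (auto intro: polynomial_function_const polynomial_function_mult)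

lemma finite_zeros_polynomial_function:
  assumes "polynomial_function \<phi>" "\<phi> s \<noteq> 0"
  shows "finite {t. \<phi> t = 0}"
proof -
  obtain P where P: "\<phi> t = poly P t" for t using assms(1) by (auto simp: polynomial_function_def)
  with assms(2) have "P \<noteq> 0" by auto
  then show ?thesis unfolding P by (rule poly_roots_finite)
qed

definition polynomial_curve :: "('k::field \<Rightarrow> 'k poly_x) \<Rightarrow> bool" where
  "polynomial_curve c \<longleftrightarrow> (\<forall>m. polynomial_function (\<lambda>t. lookup (c t) m))"

lemma polynomial_curve_const: "polynomial_curve (\<lambda>_. p)"
  by (simp add: polynomial_curve_def polynomial_function_const)

lemma polynomial_curve_line: "polynomial_curve (\<lambda>t. p + Const t * q)"
  by (simp add: polynomial_curve_def lookup_add lookup_Const_mult polynomial_function_linear)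

lemma polynomial_curve_mult:
  "polynomial_curve c \<Longrightarrow> polynomial_curve c' \<Longrightarrow> polynomial_curve (\<lambda>t. c t * c' t)"
  by (simp add: polynomial_curve_def lookup_mult_sum polynomial_function_sum polynomial_function_mult)

lemma polynomial_curve_power: "polynomial_curve c \<Longrightarrow> polynomial_curve (\<lambda>t. c t ^ n)"
  by (induction n) (auto intro: polynomial_curve_const polynomial_curve_mult)

lemma polynomial_curve_sum:
  "(\<And>x. x \<in> A \<Longrightarrow> polynomial_curve (c x)) \<Longrightarrow> polynomial_curve (\<lambda>t. \<Sum>x\<in>A. c x t)"
  by (simp add: polynomial_curve_def lookup_sum polynomial_function_sum)

lemma polynomial_function_eval:
  assumes "polynomial_curve c"
  shows "polynomial_function (\<lambda>t. eval (lookup (c t)) F)"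
  using assms unfolding eval_def polynomial_curve_def
  by (intro polynomial_function_sum polynomial_function_mult polynomial_function_const
      polynomial_function_prod polynomial_function_power) blast

lemma finite_zeros_polynomial_curve:
  assumes "polynomial_curve c" "c s \<noteq> 0"
  shows "finite {t. c t = 0}"
proof -
  from assms(2) obtain m where "lookup (c s) m \<noteq> 0" by (metis poly_mapping_eqI lookup_zero)
  with assms(1) have "finite {t. lookup (c t) m = 0}"
    by (auto simp: polynomial_curve_def intro: finite_zeros_polynomial_function)
  then show ?thesis by (rule rev_finite_subset) auto
qed

text \<open>A nonempty preimage of an open set is cofinite: a distinguished set omits finitely many
  zeros of polynomials in \<open>t\<close>, an intersection omits a union of two finite sets, and a
  union omits no more than its member through the point at \<open>s\<close>.\<close>

lemma finite_curve_minus_open: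
  fixes c :: "'k::field \<Rightarrow> 'k poly_x"
  assumes c: "polynomial_curve c" "\<And>t. c t \<in> forms d r"
    and N: "openin (zariski d r) N" and s: "c s \<noteq> 0" "proj_class (c s) \<in> N"
  shows "finite {t. c t = 0 \<or> proj_class (c t) \<notin> N}"
proof -
  have "generate_topology_on {zariski_basic d r F | F :: (nat \<Rightarrow>\<^sub>0 nat, 'k) mpoly. \<exists>e. homogeneous e F} N"
    using N by (simp add: zariski_def openin_topology_generated_by_iff)
  then show ?thesis
    using s(2)
  proof induction
    case (Int A B)
    then have "finite ({t. c t = 0 \<or> proj_class (c t) \<notin> A} \<union> {t. c t = 0 \<or> proj_class (c t) \<notin> B})"
      by simp
    then show ?case by (rule rev_finite_subset) auto
  next
    case (UN K)
    then obtain A where "A \<in> K" "proj_class (c s) \<in> A" by blast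
    with UN.IH have "finite {t. c t = 0 \<or> proj_class (c t) \<notin> A}" by blast
    then show ?case by (rule rev_finite_subset) (use \<open>A \<in> K\<close> in auto)
  next
    case (Basis A)
    then obtain e F where F: "A = zariski_basic d r F" "homogeneous e F" by blast
    have "eval (lookup (c s)) F \<noteq> 0"
      using Basis(2) proj_class_in_zariski_basic_iff[OF F(2) c(2) s(1)] by (simp add: F)
    then have "finite ({t. c t = 0} \<union> {t. eval (lookup (c t)) F = 0})"
      using finite_zeros_polynomial_function[OF polynomial_function_eval[OF c(1)], of s F]
        finite_zeros_polynomial_curve[OF c(1) s(1)] by simp
    then show ?case
      by (rule rev_finite_subset)
        (unfold F(1), use proj_class_in_zariski_basic_iff[OF F(2) c(2)] in blast)
  qed simp
qed

section \<open>Sums of powers and density\<close>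

lemma sum_of_powers_pad:
  assumes "sum_of_powers d r h q" "h \<le> h'" "d \<ge> 1"
  shows "sum_of_powers d r h' q"
proof -
  from assms(1) obtain l where l: "\<And>i. i < h \<Longrightarrow> l i \<in> forms 1 r" "q = (\<Sum>i<h. l i ^ d)"
    by (auto simp: sum_of_powers_def)
  define l' where "l' i = (if i < h then l i else 0)" for i
  have "(\<Sum>i<h. l i ^ d) = (\<Sum>i<h'. l' i ^ d)"
    using assms by (intro sum.mono_neutral_cong_left) (auto simp: l'_def power_0_left)
  then show ?thesis
    unfolding sum_of_powers_def using l by (intro exI[of _ l']) (auto simp: l'_def)
qed

lemma sum_of_powers_in_forms: "sum_of_powers d r h q \<Longrightarrow> q \<in> forms d r"
  using forms_power[of _ 1 r d] by (auto simp: sum_of_powers_def intro!: forms_sum)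

text \<open>Each linear form moves along the line to its counterpart, so the number of powers never
  grows.\<close>

lemma sum_of_powers_path:
  fixes p q :: "'k::field poly_x"
  assumes "sum_of_powers d r h p" "sum_of_powers d r h q"
  obtains c where "polynomial_curve c" "c 0 = p" "c 1 = q" "\<And>t. sum_of_powers d r h (c t)"
proof -
  from assms(1) obtain l where l: "\<And>i. i < h \<Longrightarrow> l i \<in> forms 1 r" "p = (\<Sum>i<h. l i ^ d)"
    by (auto simp: sum_of_powers_def)
  from assms(2) obtain l' where l': "\<And>i. i < h \<Longrightarrow> l' i \<in> forms 1 r" "q = (\<Sum>i<h. l' i ^ d)"
    by (auto simp: sum_of_powers_def)
  define c where "c t = (\<Sum>i<h. (l i + Const t * (l' i - l i)) ^ d)" for t
  show thesis
  proof
    show "polynomial_curve c"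
      unfolding c_def by (intro polynomial_curve_sum polynomial_curve_power polynomial_curve_line)
    show "c 0 = p" "c 1 = q" by (simp_all add: c_def l l' Const_0 Const_1)
    show "sum_of_powers d r h (c t)" for t
      unfolding sum_of_powers_def c_def
      by (intro exI[of _ "\<lambda>i. l i + Const t * (l' i - l i)"] conjI allI impI refl
          forms_add forms_Const_mult forms_diff l l')
  qed
qed

lemma at_general_point_rank_locus:
  fixes f :: "'k::field_char_0 poly_x" and d r :: nat
  defines "Q \<equiv> \<lambda>q. \<forall>g\<in>forms d r. hess_deriv r q g = 0 \<longrightarrow> g = 0"
  assumes r: "r \<ge> 1" and d: "d \<ge> 2" and f: "f \<noteq> 0" "sum_of_powers d r (r + 2) f" "Q f"
  shows "at_general_point (zariski d r) (rank_locus d r (r + 2) :: 'k poly_x set set)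
    (\<lambda>P. P \<in> hessian_domain d r \<and> inj_on (hessian_differential r) (tangent_space d r P))"
proof -
  let ?T = "zariski d r :: 'k poly_x set topology"
  define R where "R = {proj_class q | q :: 'k poly_x. q \<in> forms d r \<and> q \<noteq> 0 \<and> has_waring_rank d r q (r + 2)}"
  have R_sub: "R \<subseteq> topspace ?T" by (auto simp: R_def topspace_zariski Sigma_space_def)
  obtain e F where F: "homogeneous e F" "eval (lookup f) F \<noteq> 0" "\<And>q. eval (lookup q) F \<noteq> 0 \<Longrightarrow> Q q"
    using immersive_open[of d r f] f(3) unfolding Q_def by metis
  define O' where "O' = zariski_basic d r F"
  have O': "openin ?T O'"
    unfolding zariski_def O'_def using F(1) by (intro topology_generated_by_Basis) blast
  have Z: "rank_locus d r (r + 2) = ?T closure_of R" by (simp add: rank_locus_def R_def)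
  \<comment> \<open>Fewer powers could be padded with zeros to \<open>r + 1\<close> powers, where
    injectivity fails.\<close>
  have rank: "has_waring_rank d r q (r + 2)" if q: "sum_of_powers d r (r + 2) q" "q \<noteq> 0" "Q q" for q
    unfolding has_waring_rank_def
  proof (intro conjI allI impI q(1) notI)
    fix h assume "h < r + 2" "sum_of_powers d r h q"
    then have "sum_of_powers d r (r + 1) q" using d by (elim sum_of_powers_pad) auto
    then obtain l where l: "\<And>k. k < r + 1 \<Longrightarrow> l k \<in> forms 1 r" "q = (\<Sum>k<r + 1. l k ^ d)"
      unfolding sum_of_powers_def by blast
    have d2: "d - 2 + 2 = d" using d by simp
    have "\<exists>g\<in>forms (d - 2 + 2) r. hess_deriv r q g = 0 \<and> g \<noteq> 0"
      by (rule not_immersive_sum_of_powers[where l = l, OF r _ _ q(2)]) (use l in \<open>simp_all only: d2\<close>)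
    then have "\<exists>g\<in>forms d r. hess_deriv r q g = 0 \<and> g \<noteq> 0" by (simp only: d2)
    with q(3) show False unfolding Q_def by blast
  qed
  \<comment> \<open>On the curve from \<open>p\<close> to \<open>f\<close>, all but finitely many
    points lie in the given neighbourhood \<open>N\<close> of \<open>P\<close> and satisfy
    \<open>F \<noteq> 0\<close>. Since the field is infinite, one such point exists, and it has rank
    \<open>r + 2\<close>.\<close>
  have "R \<subseteq> ?T closure_of (O' \<inter> ?T closure_of R)"
  proof
    fix P assume P: "P \<in> R"
    then obtain p where p: "P = proj_class p" "p \<noteq> 0" "sum_of_powers d r (r + 2) p"
      by (auto simp: R_def has_waring_rank_def)
    obtain c where c: "polynomial_curve c" "c 0 = p" "c 1 = f" "\<And>t. sum_of_powers d r (r + 2) (c t)"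
      using sum_of_powers_path[OF p(3) f(2)] by blast
    have forms: "c t \<in> forms d r" for t by (rule sum_of_powers_in_forms[OF c(4)])
    show "P \<in> ?T closure_of (O' \<inter> ?T closure_of R)"
      unfolding in_closure_of
    proof (intro conjI allI impI)
      show "P \<in> topspace ?T" using P R_sub by blast
      fix N assume N: "P \<in> N \<and> openin ?T N"
      have "finite {t. c t = 0 \<or> proj_class (c t) \<notin> N}"
        using N p(1,2) c(2) by (intro finite_curve_minus_open[OF c(1) forms, of N 0]) auto
      moreover have "finite {t. eval (lookup (c t)) F = 0}"
        using F(2) c(3) by (intro finite_zeros_polynomial_function[OF polynomial_function_eval[OF c(1)], of 1]) auto
      ultimately have "finite ({t. c t = 0 \<or> proj_class (c t) \<notin> N} \<union> {t. eval (lookup (c t)) F = 0})"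
        by simp
      then obtain t where t: "c t \<noteq> 0" "proj_class (c t) \<in> N" "eval (lookup (c t)) F \<noteq> 0"
        using ex_new_if_finite[OF infinite_UNIV_char_0[where 'a = 'k]] by blast
      have "proj_class (c t) \<in> R"
        unfolding R_def using t forms[of t] rank[OF c(4) t(1) F(3)[OF t(3)]] by blast
      then have "proj_class (c t) \<in> ?T closure_of R"
        using closure_of_subset[OF R_sub] by blast
      moreover have "proj_class (c t) \<in> O'"
        unfolding O'_def using t forms by (simp add: proj_class_in_zariski_basic_iff[OF F(1)])
      ultimately show "\<exists>y. y \<in> O' \<inter> ?T closure_of R \<and> y \<in> N" using t(2) by blast
    qed
  qed
  then have dense: "?T closure_of R \<subseteq> ?T closure_of (O' \<inter> ?T closure_of R)"
    by (rule closure_of_minimal) simp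
  show ?thesis
    unfolding at_general_point_def Z
  proof (intro exI[of _ "O' \<inter> ?T closure_of R"] conjI ballI)
    show "openin (subtopology ?T (?T closure_of R)) (O' \<inter> ?T closure_of R)"
      using O' by (auto simp: openin_subtopology)
    show "subtopology ?T (?T closure_of R) closure_of (O' \<inter> ?T closure_of R) = ?T closure_of R"
      using dense by (auto simp: closure_of_subtopology Int_absorb1)
    fix P assume "P \<in> O' \<inter> ?T closure_of R"
    then obtain q where q: "P = proj_class q" "q \<in> forms d r" "q \<noteq> 0" "eval (lookup q) F \<noteq> 0"
      by (auto simp: O'_def zariski_basic_def)
    have "P \<in> hessian_domain d r \<and> inj_on (hessian_differential r) (tangent_space d r P)"
      unfolding q(1) immersion_iff[OF q(2,3)] using F(3)[OF q(4)] by (simp add: Q_def)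
    then show "P \<in> hessian_domain d r" "inj_on (hessian_differential r) (tangent_space d r P)" by auto
  qed
qed

theorem theorem7p1:
  fixes d r :: nat
    and l :: "nat \<Rightarrow> ('k :: {alg_closed_field, field_char_0}) poly_x"
    and f :: "'k poly_x"
  assumes "d \<ge> 3" and "r \<ge> 2"
    and "\<And>i. i \<le> r \<Longrightarrow> l i = Var i"
    and "l (r+1) = (\<Sum>i=0..r. Var i)"
    and "f = (\<Sum>i=0..r+1. l i ^ d)"
  shows "(proj_class f \<in> hessian_domain d r \<and>
          inj_on (hessian_differential r) (tangent_space d r (proj_class f))) \<and>
         at_general_point (zariski d r) (rank_locus d r (r+2) :: 'k poly_x set set)
           (\<lambda>P. P \<in> hessian_domain d r \<and> inj_on (hessian_differential r) (tangent_space d r P))"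
proof -
  define e where "e = d - 2"
  have d: "d = e + 2" and e: "e \<ge> 1" using assms(1) by (auto simp: e_def)
  have l: "l i \<in> forms 1 r" if "i < r + 2" for i
  proof (cases "i = r + 1")
    case True
    then show ?thesis unfolding True assms(4) by (intro forms_sum Var_in_forms) simp
  next
    case False
    then have "i \<le> r" using that by simp
    then show ?thesis using assms(3) by (simp add: Var_in_forms[simplified])
  qed
  have interval: "{0..r + 1} = {..<r + 2}" "{0..r} = {..<r + 1}" by auto
  have powers: "sum_of_powers d r (r + 2) f"
    unfolding sum_of_powers_def assms(5) interval using l by blast
  have f: "f = (\<Sum>i<r + 1. Var i ^ (e + 2)) + (\<Sum>i<r + 1. Var i) ^ (e + 2)"
  proof -
    have "(\<Sum>i<r + 1. l i ^ d) = (\<Sum>i<r + 1. Var i ^ d)"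
      by (intro sum.cong refl) (simp add: assms(3))
    then show ?thesis
      using assms(4) unfolding assms(5) interval d[symmetric] by simp
  qed
  have Q: "\<forall>g\<in>forms d r. hess_deriv r f g = 0 \<longrightarrow> g = 0"
    using power_sum_immersive[OF assms(2) e f] unfolding d by blast
  have "eval (\<lambda>_. 1) f = of_nat ((r + 1) + (r + 1) ^ (e + 2))"
    unfolding f eval_add eval_sum eval_power eval_Var
    by (simp only: power_one sum_constant card_lessThan of_nat_add of_nat_power of_nat_1 mult_1_right)
  moreover have "of_nat ((r + 1) + (r + 1) ^ (e + 2)) \<noteq> (0 :: 'k)"
    unfolding of_nat_eq_0_iff by simp
  ultimately have "f \<noteq> 0" by (metis eval_0)
  show ?thesis
  proof
    show "proj_class f \<in> hessian_domain d r \<and>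
        inj_on (hessian_differential r) (tangent_space d r (proj_class f))"
      using immersion_iff[OF sum_of_powers_in_forms[OF powers] \<open>f \<noteq> 0\<close>] Q by blast
    show "at_general_point (zariski d r) (rank_locus d r (r+2) :: 'k poly_x set set)
        (\<lambda>P. P \<in> hessian_domain d r \<and> inj_on (hessian_differential r) (tangent_space d r P))"
      using assms(1,2) \<open>f \<noteq> 0\<close> powers Q by (intro at_general_point_rank_locus[of r d f]) auto
  qed
qed

end
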